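(* Let $M$ be a smooth manifold. Let $\rho$ be a generalised metric on $M$. Then there exists a sequence $(F_n)_n$ of Finsler metrics on $M$ such that $$F_n(x,v)\nearrow\rho(x,v)\quad\text{for every }x\in M\text{ and }v\in T_xM$$ (monotonically non-decreasing convergence in $[0,+\infty]$).
   Context: A smooth manifold is a connected $C^\infty$ manifold (Hausdorff, second countable). A generalised norm on a vector space $V$ is a function $\mathsf n\colon V\to[0,+\infty]$ for which there exists a vector subspace $D(\mathsf n)\neq\{0\}$ of $V$ such that $\mathsf n|_{D(\mathsf n)}$ is a norm on $D(\mathsf n)$ and $\mathsf n(v)=+\infty$ for every $v\in V\setminus D(\mathsf n)$. A family $\{V_x\}_{x\in M}$ of subspaces $V_x\le E_x$ of the fibers of a smooth vector bundle $E$ over $M$ is a continuous distribution (of possibly varying rank) if for every $\bar x\in M$ and $\bar v\in V_{\bar x}$ there exists a continuous section $v$ of $E$ on some neighbourhood $U$ of $\bar x$ with $v(\bar x)=\bar v$ and $v(x)\in V_x$ for every $x\in U$. A generalised metric over $E$ is a lower semicontinuous function $\rho\colon E\to[0,+\infty]$ such that $\rho_x:=\rho|_{E_x}$ is a generalised norm on $E_x$ for every $x\in M$ and $\{D(\rho_x)\}_{x\in M}$ is a continuous distribution. A generalised metric on $M$ is a generalised metric over $E=TM$. A norm $\mathsf n$ on a finite-dimensional vector space $V$ is smooth if it is $C^\infty$ on $V\setminus\{0\}$, and it is strongly convex if the Hessian matrix of $\mathsf n^2$ at every $v\in V\setminus\{0\}$ is positive definite. A Finsler metric on $M$ is a continuous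 function $F\colon TM\to[0,+\infty)$ that is smooth on the complement of the zero section and such that $F|_{T_xM}$ is a strongly convex norm for every $x\in M$. *)

theory Defs
  imports "HOL-Analysis.Analysis" "HOL-Library.Function_Algebras"
begin

section \<open>Smooth maps between Euclidean spaces\<close>

text \<open>Only meant for open \<open>S\<close>.\<close>

fun Ck_on :: "nat \<Rightarrow> 'a::euclidean_space set \<Rightarrow> ('a \<Rightarrow> 'b::real_normed_vector) \<Rightarrow> bool" where
  "Ck_on 0 S f \<longleftrightarrow> continuous_on S f"
| "Ck_on (Suc k) S f \<longleftrightarrow>
     (\<forall>x\<in>S. f differentiable (at x)) \<and>
     (\<forall>u. Ck_on k S (\<lambda>x. frechet_derivative f (at x) u))"

definition smooth_on :: "'a::euclidean_space set \<Rightarrow> ('a \<Rightarrow> 'b::real_normed_vector) \<Rightarrow> bool" where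
  "smooth_on S f \<longleftrightarrow> (\<forall>k. Ck_on k S f)"

section \<open>Smooth manifolds\<close>

text \<open>
  A chart is a pair \<open>(U, \<phi>)\<close>; the values of \<open>\<phi>\<close> outside \<open>U\<close> are irrelevant.
  The underlying set of a manifold is a whole type. All charts take values in the same Euclidean
  space, which has dimension at least 1.  A zero-dimensional connected manifold is a point; its
  tangent space is zero, so that it carries no generalised metric.
\<close>

type_synonym ('a, 'e) chart = "'a set \<times> ('a \<Rightarrow> 'e)"

abbreviation chart_dom :: "('a, 'e) chart \<Rightarrow> 'a set" where
  "chart_dom c \<equiv> fst c"

abbreviation chart_map :: "('a, 'e) chart \<Rightarrow> 'a \<Rightarrow> 'e" where
  "chart_map c \<equiv> snd c"

definition is_chart :: "('a::topological_space, 'e::euclidean_space) chart \<Rightarrow> bool" where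
  "is_chart c \<longleftrightarrow> open (chart_dom c) \<and> open (chart_map c ` chart_dom c) \<and>
     (\<exists>g. homeomorphism (chart_dom c) (chart_map c ` chart_dom c) (chart_map c) g)"

definition transition_map ::
    "('a, 'e) chart \<Rightarrow> ('a, 'e) chart \<Rightarrow> 'e::euclidean_space \<Rightarrow> 'e" where
  "transition_map c d = chart_map d \<circ> inv_into (chart_dom c) (chart_map c)"

definition smooth_atlas :: "('a::topological_space, 'e::euclidean_space) chart set \<Rightarrow> bool" where
  "smooth_atlas \<A> \<longleftrightarrow>
     (\<forall>c\<in>\<A>. is_chart c) \<and> (\<Union>c\<in>\<A>. chart_dom c) = UNIV \<and>
     (\<forall>c\<in>\<A>. \<forall>d\<in>\<A>.
        smooth_on (chart_map c ` (chart_dom c \<inter> chart_dom d)) (transition_map c d))"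

text \<open>
  The Hausdorff property and second countability are the sorts of \<open>'a\<close>. The smooth structure
  is given by an arbitrary, not necessarily maximal, atlas.
\<close>

definition smooth_manifold ::
    "('a::{t2_space,second_countable_topology}, 'e::euclidean_space) chart set \<Rightarrow> bool" where
  "smooth_manifold \<A> \<longleftrightarrow> connected (UNIV :: 'a set) \<and> smooth_atlas \<A>"

section \<open>The tangent bundle\<close>

text \<open>Pointwise vector space structure on functions.\<close>

instantiation "fun" :: (type, scaleR) scaleR
begin

definition scaleR_fun :: "real \<Rightarrow> ('a \<Rightarrow> 'b) \<Rightarrow> 'a \<Rightarrow> 'b" where
  "scaleR_fun r f = (\<lambda>x. r *\<^sub>R f x)"

instance ..

end

instance "fun" :: (type, real_vector) real_vector
  by standard (simp_all add: scaleR_fun_def plus_fun_def fun_eq_iff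
      scaleR_add_right scaleR_add_left)

text \<open>
  A tangent vector at \<open>x\<close> is the family of its coordinate vectors with respect to all charts of
  the atlas around \<open>x\<close>, which are related by the Jacobians of the transition maps. The value at
  anything else than a chart around \<open>x\<close> is normalised to \<open>0\<close>.
\<close>

type_synonym ('a, 'e) tvec = "('a, 'e) chart \<Rightarrow> 'e"

definition tangent_space ::
    "('a, 'e::euclidean_space) chart set \<Rightarrow> 'a \<Rightarrow> ('a, 'e) tvec set" where
  "tangent_space \<A> x = {v.
     (\<forall>c. c \<notin> \<A> \<or> x \<notin> chart_dom c \<longrightarrow> v c = 0) \<and>
     (\<forall>c\<in>\<A>. \<forall>d\<in>\<A>. x \<in> chart_dom c \<and> x \<in> chart_dom d \<longrightarrow>
        v d = frechet_derivative (transition_map c d) (at (chart_map c x)) (v c))}"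

definition tangent_bundle ::
    "('a, 'e::euclidean_space) chart set \<Rightarrow> ('a \<times> ('a, 'e) tvec) set" where
  "tangent_bundle \<A> = Sigma UNIV (tangent_space \<A>)"

definition zero_section ::
    "('a, 'e::euclidean_space) chart set \<Rightarrow> ('a \<times> ('a, 'e) tvec) set" where
  "zero_section \<A> = UNIV \<times> {0}"

text \<open>The chart of the tangent bundle induced by a chart \<open>c\<close>, and its domain.\<close>

definition tangent_chart ::
    "('a, 'e) chart \<Rightarrow> 'a \<times> ('a, 'e) tvec \<Rightarrow> 'e \<times> 'e" where
  "tangent_chart c = (\<lambda>(x, v). (chart_map c x, v c))"

definition tangent_chart_dom ::
    "('a, 'e::euclidean_space) chart set \<Rightarrow> ('a, 'e) chart \<Rightarrow> ('a \<times> ('a, 'e) tvec) set" where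
  "tangent_chart_dom \<A> c = Sigma (chart_dom c) (tangent_space \<A>)"

definition tangent_topology ::
    "('a, 'e::euclidean_space) chart set \<Rightarrow> ('a \<times> ('a, 'e) tvec) topology" where
  "tangent_topology \<A> = topology_generated_by
     {{p \<in> tangent_chart_dom \<A> c. tangent_chart c p \<in> S} | c S. c \<in> \<A> \<and> open S}"

definition smooth_on_tangent ::
    "('a, 'e::euclidean_space) chart set \<Rightarrow> ('a \<times> ('a, 'e) tvec) set \<Rightarrow>
     ('a \<times> ('a, 'e) tvec \<Rightarrow> real) \<Rightarrow> bool" where
  "smooth_on_tangent \<A> W F \<longleftrightarrow>
     (\<forall>c\<in>\<A>. smooth_on (tangent_chart c ` (W \<inter> tangent_chart_dom \<A> c))
        (F \<circ> inv_into (tangent_chart_dom \<A> c) (tangent_chart c)))"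

section \<open>Generalised metrics\<close>

definition norm_on :: "'v::real_vector set \<Rightarrow> ('v \<Rightarrow> real) \<Rightarrow> bool" where
  "norm_on V n \<longleftrightarrow>
     (\<forall>v\<in>V. 0 \<le> n v) \<and> (\<forall>v\<in>V. n v = 0 \<longleftrightarrow> v = 0) \<and>
     (\<forall>a. \<forall>v\<in>V. n (a *\<^sub>R v) = \<bar>a\<bar> * n v) \<and>
     (\<forall>v\<in>V. \<forall>w\<in>V. n (v + w) \<le> n v + n w)"

definition generalised_norm :: "'v::real_vector set \<Rightarrow> ('v \<Rightarrow> ennreal) \<Rightarrow> bool" where
  "generalised_norm V n \<longleftrightarrow>
     (\<exists>D. subspace D \<and> D \<subseteq> V \<and> D \<noteq> {0} \<and>
        (\<forall>v\<in>D. n v < \<infinity>) \<and> norm_on D (\<lambda>v. enn2real (n v)) \<and>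
        (\<forall>v\<in>V - D. n v = \<infinity>))"

text \<open>The subspace \<open>D\<close> above is unique: it is the set where \<open>n\<close> is finite.\<close>

definition norm_dom :: "'v set \<Rightarrow> ('v \<Rightarrow> ennreal) \<Rightarrow> 'v set" where
  "norm_dom V n = {v \<in> V. n v < \<infinity>}"

definition continuous_section ::
    "('a::topological_space, 'e::euclidean_space) chart set \<Rightarrow> 'a set \<Rightarrow>
     ('a \<Rightarrow> ('a, 'e) tvec) \<Rightarrow> bool" where
  "continuous_section \<A> U s \<longleftrightarrow>
     continuous_map (top_of_set U) (tangent_topology \<A>) (\<lambda>x. (x, s x))"

definition continuous_distribution ::
    "('a::topological_space, 'e::euclidean_space) chart set \<Rightarrow>
     ('a \<Rightarrow> ('a, 'e) tvec set) \<Rightarrow> bool" where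
  "continuous_distribution \<A> D \<longleftrightarrow>
     (\<forall>x. subspace (D x) \<and> D x \<subseteq> tangent_space \<A> x) \<and>
     (\<forall>x. \<forall>v\<in>D x. \<exists>U s. open U \<and> x \<in> U \<and> continuous_section \<A> U s \<and>
        s x = v \<and> (\<forall>y\<in>U. s y \<in> D y))"

definition lower_semicontinuous_map :: "'b topology \<Rightarrow> ('b \<Rightarrow> ennreal) \<Rightarrow> bool" where
  "lower_semicontinuous_map X f \<longleftrightarrow> (\<forall>t. openin X {p \<in> topspace X. t < f p})"

text \<open>The values of \<open>\<rho>\<close> outside the tangent bundle are irrelevant.\<close>

definition generalised_metric ::
    "('a::topological_space, 'e::euclidean_space) chart set \<Rightarrow>
     ('a \<times> ('a, 'e) tvec \<Rightarrow> ennreal) \<Rightarrow> bool" where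
  "generalised_metric \<A> \<rho> \<longleftrightarrow>
     lower_semicontinuous_map (tangent_topology \<A>) \<rho> \<and>
     (\<forall>x. generalised_norm (tangent_space \<A> x) (\<lambda>v. \<rho> (x, v))) \<and>
     continuous_distribution \<A> (\<lambda>x. norm_dom (tangent_space \<A> x) (\<lambda>v. \<rho> (x, v)))"

section \<open>Finsler metrics\<close>

definition hessian :: "('e::euclidean_space \<Rightarrow> real) \<Rightarrow> 'e \<Rightarrow> 'e \<Rightarrow> 'e \<Rightarrow> real" where
  "hessian g v i j =
     frechet_derivative (\<lambda>u. frechet_derivative g (at u) j) (at v) i"

definition pos_def_hessian :: "('e::euclidean_space \<Rightarrow> real) \<Rightarrow> 'e \<Rightarrow> bool" where
  "pos_def_hessian g v \<longleftrightarrow>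
     (\<forall>w. w \<noteq> 0 \<longrightarrow>
        0 < (\<Sum>i\<in>Basis. \<Sum>j\<in>Basis. (w \<bullet> i) * hessian g v i j * (w \<bullet> j)))"

definition strongly_convex_norm :: "('e::euclidean_space \<Rightarrow> real) \<Rightarrow> bool" where
  "strongly_convex_norm n \<longleftrightarrow>
     norm_on UNIV n \<and> smooth_on (- {0}) n \<and>
     (\<forall>v. v \<noteq> 0 \<longrightarrow> pos_def_hessian (\<lambda>u. (n u)\<^sup>2) v)"

text \<open>The tangent vector at \<open>x\<close> with coordinates \<open>u\<close> in the chart \<open>c\<close> around \<open>x\<close>.\<close>

definition tangent_vector ::
    "('a, 'e::euclidean_space) chart set \<Rightarrow> 'a \<Rightarrow> ('a, 'e) chart \<Rightarrow> 'e \<Rightarrow> ('a, 'e) tvec" where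
  "tangent_vector \<A> x c u = inv_into (tangent_space \<A> x) (\<lambda>v. v c) u"

text \<open>
  Smoothness and strong convexity of the norm on \<open>T\<^sub>xM\<close> are expressed in the linear
  coordinates on \<open>T\<^sub>xM\<close> given by the charts around \<open>x\<close>; neither depends on
  the choice of linear coordinates.
\<close>

definition finsler_metric ::
    "('a::topological_space, 'e::euclidean_space) chart set \<Rightarrow>
     ('a \<times> ('a, 'e) tvec \<Rightarrow> real) \<Rightarrow> bool" where
  "finsler_metric \<A> F \<longleftrightarrow>
     (\<forall>p\<in>tangent_bundle \<A>. 0 \<le> F p) \<and>
     continuous_map (tangent_topology \<A>) euclideanreal F \<and>
     smooth_on_tangent \<A> (tangent_bundle \<A> - zero_section \<A>) F \<and>
     (\<forall>x. norm_on (tangent_space \<A> x) (\<lambda>v. F (x, v)) \<and>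
       (\<forall>c\<in>\<A>. x \<in> chart_dom c \<longrightarrow>
          strongly_convex_norm (\<lambda>u. F (x, tangent_vector \<A> x c u))))"

end

theory Submission
  imports Defs
begin

text \<open>
  It suffices to construct squares \<open>Q = F\<^sup>2\<close>. Near a point, \<open>\<rho>\<^sup>2\<close> dominates quadratic forms
  \<open>(a \<bullet> u)\<^sup>2 + \<epsilon> \<bar>u\<bar>\<^sup>2\<close> that are constant in a chart and come arbitrarily close to it at a given vector:
  the linear form is found by separating the vector from the unit ball of \<open>\<rho>\<^sub>x\<close>, and the inequality
  persists on a neighbourhood by lower semicontinuity and compactness of the unit sphere. By the Lindelof
  property countably many such forms have supremum \<open>\<rho>\<^sup>2\<close>; cutoff functions make them global minorants
  \<open>g\<^sub>i\<close>. Starting from these, \<open>Q\<^sub>n\<^sub>+\<^sub>1\<close> is a smooth approximation from above of the maximum of \<open>Q\<^sub>n\<close>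
  and a multiple, slightly less than 1, of some \<open>g\<^sub>i\<close>. The smooth maximum is sublinear and monotone and
  commutes well enough with subtracting constants to preserve moduli of strong convexity.
\<close>

section \<open>Calculus of smooth maps\<close>

text \<open>Squares are convenient because positive definiteness is a condition on the square
  anyway, because quadratic forms are smooth across the zero section and so can be multiplied by
  cutoffs and added, and because strong convexity becomes an inequality with a modulus. That
  inequality passes through sums, injective linear maps and the smooth maximum without any
  differentiation; the Hessian is derived from it only once, in
  \<open>pos_def_hessian_sq_norm\<close>. Two obstacles shape the rest. A local form times a cutoff
  is degenerate where the cutoff vanishes, so it is not the square of a norm. Hence one
  nondegenerate minorant \<open>base\<close> is glued by a partition of unity, and every local form
  is interpolated with it (\<open>extended\<close>); convex combinations stay below
  \<open>\<rho>\<^sup>2\<close>. Secondly, a smooth maximum has to lie above the maximum for the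
  sequence to increase, and then it overshoots \<open>\<rho>\<^sup>2\<close>. Hence the minorants
  are multiplied by constants increasing to 1, and each overshoot factor equals the ratio of two
  successive constants.\<close>

lemma Ck_on_cong:
  assumes "open S" "\<And>x. x \<in> S \<Longrightarrow> f x = g x" "Ck_on k S f"
  shows "Ck_on k S g"
  using assms(2,3)
proof (induction k arbitrary: f g)
  case 0
  then show ?case by (simp cong: continuous_on_cong)
next
  case (Suc k)
  have *: "g differentiable (at x)" "frechet_derivative g (at x) = frechet_derivative f (at x)"
    if "x \<in> S" for x
  proof -
    have d: "(f has_derivative frechet_derivative f (at x)) (at x)"
      using Suc.prems(2) that frechet_derivative_works by auto
    then have d': "(g has_derivative frechet_derivative f (at x)) (at x)"
      by (rule has_derivative_transform_within_open[OF _ assms(1) that]) (use Suc.prems(1) in auto)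
    then show "g differentiable (at x)" by (rule differentiableI)
    show "frechet_derivative g (at x) = frechet_derivative f (at x)"
      using frechet_derivative_at[OF d'] by simp
  qed
  have "Ck_on k S (\<lambda>x. frechet_derivative g (at x) u)" for u
    by (rule Suc.IH[of "\<lambda>x. frechet_derivative f (at x) u"]) (use Suc.prems(2) * in auto)
  with * show ?case by auto
qed

text \<open>\<open>frechet_derivative\<close> is a choice; this rule lets an explicit formula for
  the derivative take its place in the recursion.\<close>

lemma Ck_on_SucI:
  assumes "open S" "\<And>x. x \<in> S \<Longrightarrow> (f has_derivative f' x) (at x)"
    and "\<And>u. Ck_on k S (\<lambda>x. f' x u)"
  shows "Ck_on (Suc k) S f"
proof -
  have "Ck_on k S (\<lambda>x. frechet_derivative f (at x) u)" for u
    by (rule Ck_on_cong[OF assms(1) _ assms(3)[of u]]) (metis assms(2) frechet_derivative_at)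
  with assms(2) show ?thesis by (auto intro: differentiableI)
qed

lemma Ck_on_SucD: "Ck_on (Suc k) S f \<Longrightarrow> Ck_on k S f"
proof (induction k arbitrary: f)
  case 0
  then show ?case
    by (auto intro!: continuous_at_imp_continuous_on differentiable_imp_continuous_within)
next
  case (Suc k)
  then show ?case by (metis Ck_on.simps(2))
qed

lemma Ck_on_has_derivative:
  "Ck_on (Suc k) S f \<Longrightarrow> x \<in> S \<Longrightarrow> (f has_derivative frechet_derivative f (at x)) (at x)"
  using frechet_derivative_works by auto

lemma Ck_on_subset: "Ck_on k S f \<Longrightarrow> T \<subseteq> S \<Longrightarrow> Ck_on k T f"
  by (induction k arbitrary: f) (auto intro: continuous_on_subset)

lemma Ck_on_local:
  assumes "\<And>x. x \<in> S \<Longrightarrow> \<exists>T. open T \<and> x \<in> T \<and> Ck_on k T f"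
  shows "Ck_on k S f"
  using assms
proof (induction k arbitrary: f)
  case 0
  then show ?case
    by (metis Ck_on.simps(1) continuous_at_imp_continuous_on continuous_on_eq_continuous_at)
next
  case (Suc k)
  have "f differentiable (at x)" if "x \<in> S" for x
    using Suc.prems[OF that] by auto
  moreover have "Ck_on k S (\<lambda>x. frechet_derivative f (at x) u)" for u
    by (rule Suc.IH) (metis Suc.prems Ck_on.simps(2))
  ultimately show ?case by simp
qed

lemma Ck_on_const: "Ck_on k S (\<lambda>x. c)"
  by (induction k arbitrary: c) auto

lemma Ck_on_bounded_linear:
  assumes "bounded_linear f"
  shows "Ck_on k S f"
proof (cases k)
  case 0
  then show ?thesis using assms by (simp add: linear_continuous_on)
next
  case (Suc m)
  have "(f has_derivative f) (at x)" for x
    using assms by (rule bounded_linear_imp_has_derivative)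
  then have "Ck_on (Suc m) UNIV f"
    by (intro Ck_on_SucI[where f' = "\<lambda>x. f"]) (auto simp: Ck_on_const)
  then show ?thesis using Suc Ck_on_subset by blast
qed

lemma Ck_on_add:
  assumes "open S" "Ck_on k S f" "Ck_on k S g"
  shows "Ck_on k S (\<lambda>x. f x + g x)"
  using assms(2,3)
proof (induction k arbitrary: f g)
  case 0
  then show ?case by (auto intro: continuous_on_add)
next
  case (Suc k)
  show ?case
    by (rule Ck_on_SucI[OF assms(1) has_derivative_add[OF Ck_on_has_derivative[OF Suc.prems(1)]
              Ck_on_has_derivative[OF Suc.prems(2)]]])
      (use Suc in auto)
qed

lemma Ck_on_scaleR:
  assumes "open S" "Ck_on k S f" "Ck_on k S g"
  shows "Ck_on k S (\<lambda>x. f x *\<^sub>R g x)"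
  using assms(2,3)
proof (induction k arbitrary: f g)
  case 0
  then show ?case by (auto intro: continuous_on_scaleR)
next
  case (Suc k)
  show ?case
  proof (rule Ck_on_SucI[OF assms(1) has_derivative_scaleR[OF Ck_on_has_derivative[OF Suc.prems(1)]
              Ck_on_has_derivative[OF Suc.prems(2)]]])
    show "Ck_on k S (\<lambda>x. f x *\<^sub>R frechet_derivative g (at x) u + frechet_derivative f (at x) u *\<^sub>R g x)"
      for u
      using Suc.prems Suc.IH Ck_on_SucD[OF Suc.prems(1)] Ck_on_SucD[OF Suc.prems(2)]
      by (intro Ck_on_add assms(1)) auto
  qed
qed

lemma Ck_on_sum:
  assumes "open S" "\<And>i. i \<in> I \<Longrightarrow> Ck_on k S (f i)"
  shows "Ck_on k S (\<lambda>x. \<Sum>i\<in>I. f i x)"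
proof (cases "finite I")
  case True
  then show ?thesis
    using assms(2) by induction (auto simp: Ck_on_const intro: Ck_on_add[OF assms(1)])
qed (simp add: Ck_on_const)

lemma Ck_on_bounded_linear_comp:
  assumes "open S" "bounded_linear L" "Ck_on k S f"
  shows "Ck_on k S (\<lambda>x. L (f x))"
  using assms(3)
proof (induction k arbitrary: f)
  case 0
  then show ?case using assms(2) bounded_linear.continuous_on by auto
next
  case (Suc k)
  show ?case
    by (rule Ck_on_SucI[OF assms(1)
          bounded_linear.has_derivative[OF assms(2) Ck_on_has_derivative[OF Suc.prems]]])
      (use Suc in auto)
qed

lemma Ck_on_compose:
  fixes g :: "'a::euclidean_space \<Rightarrow> 'b::euclidean_space" and f :: "'b \<Rightarrow> 'c::real_normed_vector"
  assumes "open S" "open T" "Ck_on k S g" "Ck_on k T f" "g ` S \<subseteq> T"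
  shows "Ck_on k S (\<lambda>x. f (g x))"
  using assms(3,4)
proof (induction k arbitrary: f)
  case 0
  then show ?case using assms(5) continuous_on_compose2 by auto
next
  case (Suc k)
  have gS: "g x \<in> T" if "x \<in> S" for x using assms(5) that by blast
  show ?case
  proof (rule Ck_on_SucI[OF assms(1) has_derivative_compose[OF Ck_on_has_derivative[OF Suc.prems(1)]
              Ck_on_has_derivative[OF Suc.prems(2) gS]]])
    fix u
    \<comment> \<open>The chain rule evaluates the derivative of \<open>f\<close> in a direction
      that moves with \<open>x\<close>. Expanding that direction in the basis leaves products in
      which the derivative of \<open>f\<close> has a fixed direction \<open>b\<close>, and to these
      the induction hypothesis applies.\<close>
    let ?s = "\<lambda>x. \<Sum>b\<in>Basis. (frechet_derivative g (at x) u \<bullet> b) *\<^sub>R frechet_derivative f (at (g x)) b"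
    have "Ck_on k S (\<lambda>x. frechet_derivative f (at (g x)) b)" for b
      by (rule Suc.IH) (use Suc.prems Ck_on_SucD in auto)
    moreover have "Ck_on k S (\<lambda>x. frechet_derivative g (at x) u \<bullet> b)" for b
      by (rule Ck_on_bounded_linear_comp[where L = "\<lambda>z. z \<bullet> b"])
        (use Suc.prems assms(1) bounded_linear_inner_left in auto)
    ultimately have "Ck_on k S ?s"
      by (intro Ck_on_sum Ck_on_scaleR assms(1))
    moreover have "?s x = frechet_derivative f (at (g x)) (frechet_derivative g (at x) u)"
      if "x \<in> S" for x
    proof -
      have "linear (frechet_derivative f (at (g x)))"
        using Ck_on_has_derivative[OF Suc.prems(2) gS[OF that]]
        by (simp add: has_derivative_linear)
      then show ?thesis
        by (subst (2) euclidean_representation[symmetric]) (simp add: linear_sum linear_scale)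
    qed
    ultimately show "Ck_on k S (\<lambda>x. frechet_derivative f (at (g x)) (frechet_derivative g (at x) u))"
      by (rule Ck_on_cong[OF assms(1), rotated])
  qed
qed

lemma Ck_on_mult:
  fixes f g :: "'a::euclidean_space \<Rightarrow> real"
  shows "open S \<Longrightarrow> Ck_on k S f \<Longrightarrow> Ck_on k S g \<Longrightarrow> Ck_on k S (\<lambda>x. f x * g x)"
  using Ck_on_scaleR[of S k f g] by simp

lemma smooth_on_Ck_on: "smooth_on S f \<Longrightarrow> Ck_on k S f"
  by (simp add: smooth_on_def)

lemma smooth_on_imp_continuous_on: "smooth_on S f \<Longrightarrow> continuous_on S f"
  using smooth_on_Ck_on[of S f 0] by simp

lemma smooth_on_has_derivative:
  "smooth_on S f \<Longrightarrow> x \<in> S \<Longrightarrow> (f has_derivative frechet_derivative f (at x)) (at x)"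
  by (metis Ck_on_has_derivative smooth_on_def)

lemma smooth_on_frechet_derivative:
  "smooth_on S f \<Longrightarrow> smooth_on S (\<lambda>x. frechet_derivative f (at x) u)"
  unfolding smooth_on_def by (metis Ck_on.simps(2))

lemma smooth_on_subset: "smooth_on S f \<Longrightarrow> T \<subseteq> S \<Longrightarrow> smooth_on T f"
  by (auto simp: smooth_on_def intro: Ck_on_subset)

lemma smooth_on_cong:
  "open S \<Longrightarrow> (\<And>x. x \<in> S \<Longrightarrow> f x = g x) \<Longrightarrow> smooth_on S f \<Longrightarrow> smooth_on S g"
  by (auto simp: smooth_on_def intro: Ck_on_cong)

lemma smooth_on_local:
  "(\<And>x. x \<in> S \<Longrightarrow> \<exists>T. open T \<and> x \<in> T \<and> smooth_on T f) \<Longrightarrow> smooth_on S f"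
  unfolding smooth_on_def by (meson Ck_on_local)

lemma smooth_on_const: "smooth_on S (\<lambda>x. c)"
  by (simp add: smooth_on_def Ck_on_const)

lemma smooth_on_bounded_linear: "bounded_linear f \<Longrightarrow> smooth_on S f"
  by (simp add: smooth_on_def Ck_on_bounded_linear)

lemma smooth_on_bounded_linear_comp:
  "open S \<Longrightarrow> bounded_linear L \<Longrightarrow> smooth_on S f \<Longrightarrow> smooth_on S (\<lambda>x. L (f x))"
  by (simp add: smooth_on_def Ck_on_bounded_linear_comp)

lemma smooth_on_add:
  "open S \<Longrightarrow> smooth_on S f \<Longrightarrow> smooth_on S g \<Longrightarrow> smooth_on S (\<lambda>x. f x + g x)"
  by (simp add: smooth_on_def Ck_on_add)

lemma smooth_on_scaleR:
  "open S \<Longrightarrow> smooth_on S f \<Longrightarrow> smooth_on S g \<Longrightarrow> smooth_on S (\<lambda>x. f x *\<^sub>R g x)"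
  by (simp add: smooth_on_def Ck_on_scaleR)

lemma smooth_on_mult:
  fixes f g :: "'a::euclidean_space \<Rightarrow> real"
  shows "open S \<Longrightarrow> smooth_on S f \<Longrightarrow> smooth_on S g \<Longrightarrow> smooth_on S (\<lambda>x. f x * g x)"
  by (simp add: smooth_on_def Ck_on_mult)

lemma smooth_on_diff:
  "open S \<Longrightarrow> smooth_on S f \<Longrightarrow> smooth_on S g \<Longrightarrow> smooth_on S (\<lambda>x. f x - g x)"
  using smooth_on_add[of S f "\<lambda>x. (-1) *\<^sub>R g x"] smooth_on_scaleR[of S "\<lambda>x. -1" g]
  by (simp add: smooth_on_const)

lemma smooth_on_sum:
  "open S \<Longrightarrow> (\<And>i. i \<in> I \<Longrightarrow> smooth_on S (f i)) \<Longrightarrow> smooth_on S (\<lambda>x. \<Sum>i\<in>I. f i x)"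
  by (simp add: smooth_on_def Ck_on_sum)

lemma smooth_on_prod:
  fixes f :: "'i \<Rightarrow> 'a::euclidean_space \<Rightarrow> real"
  assumes "open S" "\<And>i. i \<in> I \<Longrightarrow> smooth_on S (f i)"
  shows "smooth_on S (\<lambda>x. \<Prod>i\<in>I. f i x)"
proof (cases "finite I")
  case True
  then show ?thesis
    using assms(2) by induction (auto simp: smooth_on_const intro: smooth_on_mult[OF assms(1)])
qed (simp add: smooth_on_const)

lemma smooth_on_compose:
  fixes g :: "'a::euclidean_space \<Rightarrow> 'b::euclidean_space"
  shows "open S \<Longrightarrow> open T \<Longrightarrow> smooth_on S g \<Longrightarrow> smooth_on T f \<Longrightarrow> g ` S \<subseteq> T \<Longrightarrow>
    smooth_on S (\<lambda>x. f (g x))"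
  by (simp add: smooth_on_def Ck_on_compose)

lemma smooth_on_Pair:
  fixes f :: "'a::euclidean_space \<Rightarrow> 'b::euclidean_space" and g :: "'a \<Rightarrow> 'c::euclidean_space"
  assumes "open S" "smooth_on S f" "smooth_on S g"
  shows "smooth_on S (\<lambda>x. (f x, g x))"
proof -
  have "bounded_linear (\<lambda>x. (x, 0 :: 'c))" "bounded_linear (\<lambda>x. (0 :: 'b, x))"
    by (intro bounded_linear_intros)+
  from smooth_on_bounded_linear_comp[OF assms(1) this(1) assms(2)]
    smooth_on_bounded_linear_comp[OF assms(1) this(2) assms(3)]
  show ?thesis using smooth_on_add[OF assms(1)] by fastforce
qed

section \<open>Smoothness of reciprocals, square roots and inner products\<close>

lemma smooth_on_inverse: "smooth_on {0<..} (inverse :: real \<Rightarrow> real)"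
proof -
  have "Ck_on k {0<..} (inverse :: real \<Rightarrow> real)" for k
  proof (induction k)
    case 0
    then show ?case by (auto intro!: continuous_intros)
  next
    case (Suc k)
    show ?case
      by (rule Ck_on_SucI[where f' = "\<lambda>x u. - (inverse x * u * inverse x)"])
        (auto intro!: has_derivative_inverse' Ck_on_mult Suc Ck_on_const
          Ck_on_bounded_linear_comp[where L = uminus] bounded_linear_minus bounded_linear_ident)
  qed
  then show ?thesis by (simp add: smooth_on_def)
qed

text \<open>The derivative is half of \<open>inverse (sqrt x)\<close>, which by composition is as
  often differentiable as \<open>sqrt\<close> is already known to be; hence the induction.\<close>

lemma smooth_on_sqrt: "smooth_on {0<..} sqrt"
proof -
  have "Ck_on k {0<..} sqrt" for k
  proof (induction k)
    case 0
    then show ?case by (auto intro!: continuous_intros)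
  next
    case (Suc k)
    have i: "Ck_on k {0<..} (\<lambda>x. inverse (sqrt x))"
      by (rule Ck_on_compose[where T = "{0<..}"])
        (auto intro: Suc smooth_on_Ck_on smooth_on_inverse)
    show ?case
    proof (rule Ck_on_SucI[where f' = "\<lambda>x u. inverse (sqrt x) * (u / 2)"])
      show "(sqrt has_derivative (\<lambda>u. inverse (sqrt x) * (u / 2))) (at x)" if "x \<in> {0<..}" for x
      proof -
        have "(sqrt has_derivative (*) (inverse (sqrt x) / 2)) (at x)"
          using DERIV_real_sqrt[of x] that by (simp only: has_field_derivative_def greaterThan_iff)
        moreover have "(*) (inverse (sqrt x) / 2) = (\<lambda>u. inverse (sqrt x) * (u / 2))"
          by (rule ext) simp
        ultimately show ?thesis by simp
      qed
    qed (intro Ck_on_mult i Ck_on_const open_greaterThan)+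
  qed
  then show ?thesis by (simp add: smooth_on_def)
qed

lemma smooth_on_divide:
  fixes f g :: "'a::euclidean_space \<Rightarrow> real"
  assumes "open S" "smooth_on S f" "smooth_on S g" "\<And>x. x \<in> S \<Longrightarrow> 0 < g x"
  shows "smooth_on S (\<lambda>x. f x / g x)"
proof -
  have "smooth_on S (\<lambda>x. inverse (g x))"
    by (rule smooth_on_compose[OF assms(1) open_greaterThan assms(3) smooth_on_inverse])
      (use assms(4) in auto)
  from smooth_on_mult[OF assms(1,2) this] show ?thesis by (simp add: divide_inverse)
qed

lemma smooth_on_real_sqrt:
  fixes g :: "'a::euclidean_space \<Rightarrow> real"
  assumes "open S" "smooth_on S g" "\<And>x. x \<in> S \<Longrightarrow> 0 < g x"
  shows "smooth_on S (\<lambda>x. sqrt (g x))"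
  by (rule smooth_on_compose[OF assms(1) open_greaterThan assms(2) smooth_on_sqrt])
    (use assms(3) in auto)

lemma smooth_on_inner:
  fixes f g :: "'a::euclidean_space \<Rightarrow> 'b::euclidean_space"
  assumes "open S" "smooth_on S f" "smooth_on S g"
  shows "smooth_on S (\<lambda>x. f x \<bullet> g x)"
proof -
  have "smooth_on S (\<lambda>x. h x \<bullet> b)" if "smooth_on S h" for h :: "'a \<Rightarrow> 'b" and b
    by (rule smooth_on_bounded_linear_comp[OF assms(1) bounded_linear_inner_left that])
  then have "smooth_on S (\<lambda>x. \<Sum>b\<in>Basis. (f x \<bullet> b) * (g x \<bullet> b))"
    using assms by (intro smooth_on_sum smooth_on_mult) auto
  moreover have "(\<lambda>x. \<Sum>b\<in>Basis. (f x \<bullet> b) * (g x \<bullet> b)) = (\<lambda>x. f x \<bullet> g x)"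
    by (rule ext) (rule euclidean_inner[symmetric])
  ultimately show ?thesis by simp
qed

section \<open>Smooth plateau functions\<close>

text \<open>\<open>flat 0\<close> is the classical exp(-1/t), extended by 0. With the powers of 1/t
  the linear span of the family is closed under differentiation, so that one induction reaches all
  orders.\<close>

definition flat :: "nat \<Rightarrow> real \<Rightarrow> real" where
  "flat n t = (if t > 0 then exp (- inverse t) * inverse t ^ n else 0)"

lemma power_le_fact_mult_exp:
  fixes x :: real
  assumes "0 \<le> x"
  shows "x ^ n \<le> fact n * exp x"
proof -
  have "(\<Sum>i\<in>{n}. x ^ i /\<^sub>R fact i) \<le> exp x"
    unfolding exp_def
    by (rule sum_le_suminf) (use assms summable_exp_generic[of x] in auto)
  then show ?thesis by (simp add: field_simps)
qed

text \<open>The term of degree n + 2 of the exponential series, taken at 1/t, leaves two powers of t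
  to spare. This makes the derivative at the origin vanish.\<close>

lemma flat_bound: "\<bar>flat n t\<bar> \<le> fact (n + 2) * t\<^sup>2"
proof (cases "t > 0")
  case True
  then have "inverse t ^ (n + 2) * exp (- inverse t) \<le> fact (n + 2)"
    using power_le_fact_mult_exp[of "inverse t" "n + 2"]
    by (simp add: exp_minus field_simps)
  then have "inverse t ^ (n + 2) * exp (- inverse t) * t\<^sup>2 \<le> fact (n + 2) * t\<^sup>2"
    by (rule mult_right_mono) simp
  moreover have "inverse t ^ (n + 2) * exp (- inverse t) * t\<^sup>2 = flat n t"
    using True by (simp add: flat_def power_add power2_eq_square field_simps)
  moreover have "0 \<le> flat n t" using True by (simp add: flat_def)
  ultimately show ?thesis by simp
qed (simp add: flat_def)

lemma flat_DERIV:
  "(flat n has_real_derivative flat (n + 2) t - real n * flat (n + 1) t) (at t)"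
proof -
  consider "t < 0" | "t = 0" | "t > 0" by linarith
  then show ?thesis
  proof cases
    case 1
    have "((\<lambda>_. 0) has_real_derivative 0) (at t)" by simp
    then have "(flat n has_real_derivative 0) (at t)"
      by (rule has_field_derivative_transform_within_open[where S = "{..<0}"])
        (use 1 in \<open>auto simp: flat_def\<close>)
    with 1 show ?thesis by (simp add: flat_def)
  next
    case 2
    have "((\<lambda>h. flat n h / h) \<longlongrightarrow> 0) (at 0)"
    proof (rule Lim_null_comparison)
      show "\<forall>\<^sub>F h in at 0. norm (flat n h / h) \<le> fact (n + 2) * \<bar>h\<bar>"
      proof (rule eventually_at_filter[THEN iffD2], rule always_eventually, intro allI impI)
        fix h :: real assume "h \<noteq> 0"
        then show "norm (flat n h / h) \<le> fact (n + 2) * \<bar>h\<bar>"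
          using flat_bound[of n h]
          by (simp add: divide_le_eq power2_eq_square mult.assoc abs_mult_self_eq)
      qed
      show "((\<lambda>h. fact (n + 2) * \<bar>h\<bar>) \<longlongrightarrow> 0) (at (0 :: real))"
        by (rule tendsto_eq_intros | simp)+
    qed
    with 2 show ?thesis by (simp add: DERIV_def flat_def)
  next
    case 3
    have "((\<lambda>t. exp (- inverse t) * inverse t ^ n) has_real_derivative
        flat (n + 2) t - real n * flat (n + 1) t) (at t)"
    proof (rule DERIV_cong[OF DERIV_mult])
      show "((\<lambda>t. exp (- inverse t)) has_real_derivative exp (- inverse t) * (inverse t)\<^sup>2) (at t)"
        using 3 by (auto intro!: derivative_eq_intros simp: power2_eq_square)
      show "((\<lambda>t. inverse t ^ n) has_real_derivative real n * inverse t ^ (n - 1) * - ((inverse t)\<^sup>2)) (at t)"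
        using 3 by (auto intro!: derivative_eq_intros simp: power2_eq_square)
    qed (use 3 in \<open>cases n; simp add: flat_def power2_eq_square algebra_simps\<close>)
    then show ?thesis
      by (rule has_field_derivative_transform_within_open[where S = "{0<..}"])
        (use 3 in \<open>auto simp: flat_def\<close>)
  qed
qed

lemma smooth_on_flat: "smooth_on UNIV (flat n)"
proof -
  have "Ck_on k UNIV (flat n)" for k n
  proof (induction k arbitrary: n)
    case 0
    then show ?case
      by (simp, intro continuous_at_imp_continuous_on ballI DERIV_isCont[OF flat_DERIV])
  next
    case (Suc k)
    show ?case
    proof (rule Ck_on_SucI[where f' = "\<lambda>t u. (flat (n + 2) t + (- real n) * flat (n + 1) t) * u"])
      show "(flat n has_derivative (\<lambda>u. (flat (n + 2) t + (- real n) * flat (n + 1) t) * u)) (at t)" for t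
        using flat_DERIV[of n t] by (simp add: has_field_derivative_def)
    qed (intro Ck_on_mult Ck_on_add Suc Ck_on_const open_UNIV)+
  qed
  then show ?thesis by (simp add: smooth_on_def)
qed

lemma flat_nonneg: "0 \<le> flat n t"
  by (simp add: flat_def)

lemma flat_pos: "0 < t \<Longrightarrow> 0 < flat n t"
  by (simp add: flat_def)

lemma flat_zero: "t \<le> 0 \<Longrightarrow> flat n t = 0"
  by (simp add: flat_def)

text \<open>A smooth step from 1 on s \<le> 1 to 0 on s \<ge> 2. Here s is the squared distance
  relative to \<open>r\<close>, since the distance itself is not smooth at \<open>a\<close>.\<close>

definition plateau :: "'e::euclidean_space \<Rightarrow> real \<Rightarrow> 'e \<Rightarrow> real" where
  "plateau a r y = (let s = ((y - a) \<bullet> (y - a)) / r\<^sup>2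
     in flat 0 (2 - s) / (flat 0 (2 - s) + flat 0 (s - 1)))"

text \<open>The arguments 2 - s and s - 1 add up to 1, so at least one of them is positive.\<close>

lemma plateau_denominator_pos: "0 < flat 0 (2 - s) + flat 0 (s - 1)"
  using flat_nonneg[of 0 "2 - s"] flat_nonneg[of 0 "s - 1"] flat_pos[of "2 - s" 0] flat_pos[of "s - 1" 0]
  by linarith

lemma smooth_on_plateau: "smooth_on UNIV (plateau a r)"
proof -
  define s where "s y = ((y - a) \<bullet> (y - a)) * inverse (r\<^sup>2)" for y
  have "smooth_on UNIV (\<lambda>y. y - a)"
    by (intro smooth_on_diff smooth_on_bounded_linear bounded_linear_ident smooth_on_const open_UNIV)
  then have s: "smooth_on UNIV s"
    unfolding s_def by (intro smooth_on_mult smooth_on_inner smooth_on_const open_UNIV)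
  have "smooth_on UNIV (\<lambda>y. flat 0 (2 - s y))" "smooth_on UNIV (\<lambda>y. flat 0 (s y - 1))"
    by (rule smooth_on_compose[OF open_UNIV open_UNIV _ smooth_on_flat],
        auto intro!: smooth_on_diff smooth_on_const s)+
  then have "smooth_on UNIV (\<lambda>y. flat 0 (2 - s y) / (flat 0 (2 - s y) + flat 0 (s y - 1)))"
    by (intro smooth_on_divide smooth_on_add open_UNIV plateau_denominator_pos)
  then show ?thesis
    unfolding plateau_def Let_def s_def divide_inverse .
qed

lemma plateau_nonneg: "0 \<le> plateau a r y"
  unfolding plateau_def Let_def
  by (intro divide_nonneg_pos flat_nonneg plateau_denominator_pos)

lemma plateau_le_1: "plateau a r y \<le> 1"
  unfolding plateau_def Let_def
  by (subst divide_le_eq_1_pos[OF plateau_denominator_pos]) (simp add: flat_nonneg)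

lemma plateau_eq_1:
  assumes "0 < r" "dist y a \<le> r"
  shows "plateau a r y = 1"
proof -
  have "(y - a) \<bullet> (y - a) \<le> r\<^sup>2"
    using assms by (metis dist_norm norm_ge_zero power2_norm_eq_inner power_mono)
  then have "((y - a) \<bullet> (y - a)) / r\<^sup>2 \<le> 1" using assms(1) by simp
  then show ?thesis
    unfolding plateau_def Let_def using flat_pos[of "2 - ((y - a) \<bullet> (y - a)) / r\<^sup>2" 0]
    by (simp add: flat_zero)
qed

lemma plateau_eq_0:
  assumes "0 < r" "2 * r \<le> dist y a"
  shows "plateau a r y = 0"
proof -
  have "(2 * r)\<^sup>2 \<le> (y - a) \<bullet> (y - a)"
    using assms by (metis dist_norm less_imp_le mult_nonneg_nonneg power2_norm_eq_inner power_mono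
        zero_le_numeral)
  moreover have "0 < r\<^sup>2" using assms(1) by simp
  ultimately have "2 \<le> ((y - a) \<bullet> (y - a)) / r\<^sup>2"
    by (simp add: le_divide_eq power_mult_distrib) (use zero_le_power2[of r] in linarith)
  then show ?thesis unfolding plateau_def Let_def by (simp add: flat_zero)
qed

section \<open>Strongly convex squares of norms\<close>

text \<open>
  The function \<open>q\<close> is the square of a norm that is strongly convex with modulus \<open>\<beta>\<close>; the modulus
  is only required to be positive and homogeneous, so that it need not be compared with a norm.
\<close>

definition sq_norm_with :: "'v::real_vector set \<Rightarrow> ('v \<Rightarrow> real) \<Rightarrow> ('v \<Rightarrow> real) \<Rightarrow> bool" where
  "sq_norm_with V q \<beta> \<longleftrightarrow>
     (\<forall>v\<in>V. v \<noteq> 0 \<longrightarrow> 0 < \<beta> v) \<and> (\<forall>v\<in>V. \<forall>a. \<beta> (a *\<^sub>R v) = a\<^sup>2 * \<beta> v) \<and>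
     (\<forall>v\<in>V. \<forall>a. q (a *\<^sub>R v) = a\<^sup>2 * q v) \<and>
     (\<forall>v\<in>V. \<forall>w\<in>V. \<forall>t. 0 \<le> t \<and> t \<le> 1 \<longrightarrow>
        q ((1 - t) *\<^sub>R v + t *\<^sub>R w) \<le> (1 - t) * q v + t * q w - t * (1 - t) * \<beta> (v - w))"

definition sq_norm_on :: "'v::real_vector set \<Rightarrow> ('v \<Rightarrow> real) \<Rightarrow> bool" where
  "sq_norm_on V q \<longleftrightarrow> (\<exists>\<beta>. sq_norm_with V q \<beta>)"

lemma sq_norm_withI:
  assumes "\<And>v. v \<in> V \<Longrightarrow> v \<noteq> 0 \<Longrightarrow> 0 < \<beta> v"
    and "\<And>v a. v \<in> V \<Longrightarrow> \<beta> (a *\<^sub>R v) = a\<^sup>2 * \<beta> v"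
    and "\<And>v a. v \<in> V \<Longrightarrow> q (a *\<^sub>R v) = a\<^sup>2 * q v"
    and "\<And>v w t. v \<in> V \<Longrightarrow> w \<in> V \<Longrightarrow> 0 \<le> t \<Longrightarrow> t \<le> 1 \<Longrightarrow>
      q ((1 - t) *\<^sub>R v + t *\<^sub>R w) \<le> (1 - t) * q v + t * q w - t * (1 - t) * \<beta> (v - w)"
  shows "sq_norm_with V q \<beta>"
  unfolding sq_norm_with_def using assms by simp

context
  fixes V :: "'v::real_vector set" and q \<beta>
  assumes b: "sq_norm_with V q \<beta>"
begin

lemma sq_norm_with_pos: "v \<in> V \<Longrightarrow> v \<noteq> 0 \<Longrightarrow> 0 < \<beta> v"
  using b unfolding sq_norm_with_def by simp

lemma sq_norm_with_scale: "v \<in> V \<Longrightarrow> \<beta> (a *\<^sub>R v) = a\<^sup>2 * \<beta> v"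
  using b unfolding sq_norm_with_def by simp

lemma sq_norm_with_scale': "v \<in> V \<Longrightarrow> q (a *\<^sub>R v) = a\<^sup>2 * q v"
  using b unfolding sq_norm_with_def by simp

lemma sq_norm_with_convex:
  "v \<in> V \<Longrightarrow> w \<in> V \<Longrightarrow> 0 \<le> t \<Longrightarrow> t \<le> 1 \<Longrightarrow>
    q ((1 - t) *\<^sub>R v + t *\<^sub>R w) \<le> (1 - t) * q v + t * q w - t * (1 - t) * \<beta> (v - w)"
  using b unfolding sq_norm_with_def by simp

lemma sq_norm_with_nonneg: "v \<in> V \<Longrightarrow> 0 \<le> \<beta> v"
  using sq_norm_with_pos[of v] sq_norm_with_scale[of v 0] by (cases "v = 0") auto

end

lemma sq_norm_on_scale: "sq_norm_on V q \<Longrightarrow> v \<in> V \<Longrightarrow> q (a *\<^sub>R v) = a\<^sup>2 * q v"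
  unfolding sq_norm_on_def by (metis sq_norm_with_scale')

lemma sq_norm_on_zero: "sq_norm_on V q \<Longrightarrow> 0 \<in> V \<Longrightarrow> q 0 = 0"
  using sq_norm_on_scale[of V q 0 0] by simp

text \<open>The midpoint of \<open>v\<close> and \<open>- v\<close> is 0, and strong convexity there
  reads \<open>q 0 \<le> q v - \<beta> v\<close>.\<close>

lemma sq_norm_on_pos:
  assumes "sq_norm_on V q" "subspace V" "v \<in> V" "v \<noteq> 0"
  shows "0 < q v"
proof -
  obtain \<beta> where b: "sq_norm_with V q \<beta>" using assms(1) sq_norm_on_def by blast
  have m: "- v \<in> V" using assms(2,3) subspace_neg by blast
  have "q (- v) = q v" using sq_norm_on_scale[OF assms(1,3), of "-1"] by simp
  moreover have "v - - v = 2 *\<^sub>R v" by (simp add: scaleR_2)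
  ultimately have "q 0 \<le> q v - \<beta> v"
    using sq_norm_with_convex[OF b assms(3) m, of "1/2"] sq_norm_with_scale[OF b assms(3), of 2]
    by (simp add: field_simps)
  moreover have "q 0 = 0" using sq_norm_on_zero assms subspace_0 by blast
  ultimately show ?thesis using sq_norm_with_pos[OF b assms(3,4)] by simp
qed

lemma sq_norm_on_nonneg: "sq_norm_on V q \<Longrightarrow> subspace V \<Longrightarrow> v \<in> V \<Longrightarrow> 0 \<le> q v"
  using sq_norm_on_pos[of V q v] sq_norm_on_zero[of V q] by (cases "v = 0") auto

lemma sq_norm_on_imp_norm_on:
  assumes q: "sq_norm_on V q" and V: "subspace V"
  shows "norm_on V (\<lambda>v. sqrt (q v))"
proof -
  obtain \<beta> where b: "sq_norm_with V q \<beta>" using q sq_norm_on_def by blast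
  have tri: "sqrt (q (v + w)) \<le> sqrt (q v) + sqrt (q w)" if vw: "v \<in> V" "w \<in> V" for v w
  proof (cases "v = 0 \<or> w = 0")
    case True
    then show ?thesis using sq_norm_on_zero[OF q subspace_0[OF V]] by auto
  next
    case False
    define a where "a = sqrt (q v)"
    define c where "c = sqrt (q w)"
    have pos: "0 < a" "0 < c" using False vw sq_norm_on_pos[OF q V] by (simp_all add: a_def c_def)
    have sq: "q v = a\<^sup>2" "q w = c\<^sup>2"
      using vw sq_norm_on_nonneg[OF q V] by (simp_all add: a_def c_def)
    \<comment> \<open>The vectors normalised to \<open>q x = q y = 1\<close> combine with weights
      a/(a+c) and c/(a+c) to (v+w)/(a+c), which therefore lies in the convex set where
      \<open>q\<close> is at most 1.\<close>
    define t where "t = c / (a + c)"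
    have t: "0 \<le> t" "t \<le> 1" "1 - t = a / (a + c)" using pos by (simp_all add: t_def field_simps)
    define x where "x = (1 / a) *\<^sub>R v"
    define y where "y = (1 / c) *\<^sub>R w"
    have xy: "x \<in> V" "y \<in> V" using vw V by (simp_all add: x_def y_def subspace_scale)
    have q1: "q x = 1" "q y = 1"
      using vw pos by (simp_all add: x_def y_def sq_norm_on_scale[OF q] sq power_divide)
    have e: "(1 - t) *\<^sub>R x + t *\<^sub>R y = (1 / (a + c)) *\<^sub>R (v + w)"
      using pos unfolding t(3) by (simp add: x_def y_def t_def scaleR_add_right)
    have "t * (1 - t) * \<beta> (x - y) \<ge> 0"
      using t(1,2) by (intro mult_nonneg_nonneg sq_norm_with_nonneg[OF b] subspace_diff V xy) auto
    then have "q ((1 / (a + c)) *\<^sub>R (v + w)) \<le> 1"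
      using sq_norm_with_convex[OF b xy t(1,2)] q1 e by simp
    then have "(1 / (a + c))\<^sup>2 * q (v + w) \<le> 1"
      using sq_norm_on_scale[OF q subspace_add[OF V vw]] by simp
    then have "q (v + w) \<le> (a + c)\<^sup>2"
      using pos by (simp add: power_divide divide_le_eq)
    then show ?thesis
      using pos real_le_lsqrt unfolding a_def[symmetric] c_def[symmetric]
      by (simp add: real_le_lsqrt)
  qed
  show ?thesis
    unfolding norm_on_def
    using sq_norm_on_nonneg[OF q V] sq_norm_on_pos[OF q V] sq_norm_on_zero[OF q subspace_0[OF V]]
      sq_norm_on_scale[OF q] tri
    by (fastforce simp: real_sqrt_mult)
qed

lemma sq_norm_on_pos_scale:
  assumes "sq_norm_on V q" "0 < s"
  shows "sq_norm_on V (\<lambda>v. s * q v)"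
proof -
  obtain \<beta> where b: "sq_norm_with V q \<beta>" using assms(1) sq_norm_on_def by blast
  have "s * q ((1 - t) *\<^sub>R v + t *\<^sub>R w)
      \<le> (1 - t) * (s * q v) + t * (s * q w) - t * (1 - t) * (s * \<beta> (v - w))"
    if "v \<in> V" "w \<in> V" "0 \<le> t" "t \<le> 1" for v w t
  proof -
    have "s * q ((1 - t) *\<^sub>R v + t *\<^sub>R w) \<le> s * ((1 - t) * q v + t * q w - t * (1 - t) * \<beta> (v - w))"
      using sq_norm_with_convex[OF b that] assms(2) by (intro mult_left_mono) auto
    then show ?thesis by (simp add: algebra_simps)
  qed
  then have "sq_norm_with V (\<lambda>v. s * q v) (\<lambda>v. s * \<beta> v)"
    using assms(2) by (intro sq_norm_withI)
      (simp_all add: sq_norm_with_pos[OF b] sq_norm_with_scale[OF b] sq_norm_with_scale'[OF b])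
  then show ?thesis using sq_norm_on_def by blast
qed

lemma sq_norm_on_add:
  assumes "sq_norm_on V p" "sq_norm_on V q"
  shows "sq_norm_on V (\<lambda>v. p v + q v)"
proof -
  obtain \<beta> \<gamma> where b: "sq_norm_with V p \<beta>" and c: "sq_norm_with V q \<gamma>"
    using assms sq_norm_on_def by blast
  have "sq_norm_with V (\<lambda>v. p v + q v) (\<lambda>v. \<beta> v + \<gamma> v)"
  proof (rule sq_norm_withI)
    fix v w and t :: real assume "v \<in> V" "w \<in> V" "0 \<le> t" "t \<le> 1"
    from sq_norm_with_convex[OF b this] sq_norm_with_convex[OF c this]
    show "p ((1 - t) *\<^sub>R v + t *\<^sub>R w) + q ((1 - t) *\<^sub>R v + t *\<^sub>R w)
        \<le> (1 - t) * (p v + q v) + t * (p w + q w) - t * (1 - t) * (\<beta> (v - w) + \<gamma> (v - w))"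
      by (simp add: algebra_simps)
  qed (auto intro!: add_pos_pos sq_norm_with_pos[OF b] sq_norm_with_pos[OF c]
      simp: sq_norm_with_scale[OF b] sq_norm_with_scale[OF c] sq_norm_with_scale'[OF b]
        sq_norm_with_scale'[OF c] algebra_simps)
  then show ?thesis using sq_norm_on_def by blast
qed

text \<open>Shaped for a partition of unity, where a local form is meaningful only at points at
  which its weight is nonzero. The terms of weight 0 are discarded before the induction.\<close>

lemma sq_norm_on_sum:
  assumes "finite I" "\<And>i. i \<in> I \<Longrightarrow> 0 \<le> w i" "(\<Sum>i\<in>I. w i) \<noteq> 0"
    and "\<And>i. i \<in> I \<Longrightarrow> w i \<noteq> 0 \<Longrightarrow> sq_norm_on V (q i)"
  shows "sq_norm_on V (\<lambda>v. \<Sum>i\<in>I. w i * q i v)"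
proof -
  define J where "J = {i \<in> I. w i \<noteq> 0}"
  have "(\<Sum>i\<in>I. w i) = (\<Sum>i\<in>J. w i)"
    by (rule sum.mono_neutral_right) (auto simp: J_def assms(1))
  with assms(3) have "J \<noteq> {}" by auto
  have "finite J" using assms(1) by (simp add: J_def)
  moreover note \<open>J \<noteq> {}\<close>
  moreover have "\<forall>i\<in>J. 0 < w i \<and> sq_norm_on V (q i)"
    using assms(2,4) by (force simp: J_def less_le)
  ultimately have "sq_norm_on V (\<lambda>v. \<Sum>i\<in>J. w i * q i v)"
  proof (induction J rule: finite_ne_induct)
    case (singleton i)
    then show ?case by (simp add: sq_norm_on_pos_scale)
  next
    case (insert i F)
    then show ?case by (simp add: sq_norm_on_add sq_norm_on_pos_scale)
  qed
  moreover have "(\<Sum>i\<in>J. w i * q i v) = (\<Sum>i\<in>I. w i * q i v)" for v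
    by (rule sum.mono_neutral_left) (auto simp: J_def assms(1))
  ultimately show ?thesis by simp
qed

text \<open>Injectivity on \<open>W\<close> keeps the pulled back modulus positive. Used in both
  directions between tangent vectors and their coordinates.\<close>

lemma sq_norm_on_linear_comp:
  assumes q: "sq_norm_on V q" and f: "linear f" and W: "f ` W \<subseteq> V" "subspace W"
    and ker: "\<And>w. w \<in> W \<Longrightarrow> f w = 0 \<Longrightarrow> w = 0"
  shows "sq_norm_on W (\<lambda>w. q (f w))"
proof -
  obtain \<beta> where b: "sq_norm_with V q \<beta>" using q sq_norm_on_def by blast
  have fW: "f w \<in> V" if "w \<in> W" for w using W that by blast
  have "sq_norm_with W (\<lambda>w. q (f w)) (\<lambda>w. \<beta> (f w))"
  proof (rule sq_norm_withI)
    fix v w and t :: real assume vw: "v \<in> W" "w \<in> W" "0 \<le> t" "t \<le> 1"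
    then show "q (f ((1 - t) *\<^sub>R v + t *\<^sub>R w))
        \<le> (1 - t) * q (f v) + t * q (f w) - t * (1 - t) * \<beta> (f (v - w))"
      using sq_norm_with_convex[OF b fW fW, of v w t] f
      by (simp add: linear_add linear_scale linear_diff)
  qed (use ker fW in \<open>auto simp: linear_scale[OF f] sq_norm_with_scale[OF b]
        sq_norm_with_scale'[OF b] intro!: sq_norm_with_pos[OF b]\<close>)
  then show ?thesis using sq_norm_on_def by blast
qed

section \<open>From strong convexity to positive definite Hessians\<close>

lemma linear_eq_sum_Basis:
  fixes f :: "'a::euclidean_space \<Rightarrow> 'b::real_vector"
  assumes "linear f"
  shows "f w = (\<Sum>b\<in>Basis. (w \<bullet> b) *\<^sub>R f b)"
proof -
  have "f w = f (\<Sum>b\<in>Basis. (w \<bullet> b) *\<^sub>R b)" by (simp only: euclidean_representation)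
  then show ?thesis by (simp only: linear_sum[OF assms] linear_scale[OF assms])
qed

text \<open>Strong convexity bounds the symmetric second difference of \<open>f\<close> at
  \<open>v\<close> in direction \<open>w\<close> from below by
  \<open>2 * \<beta> w * s\<^sup>2\<close>, hence the second derivative \<open>m\<close> in that
  direction by \<open>2 * \<beta> w\<close>.\<close>

lemma pos_def_hessian_sq_norm:
  fixes f :: "'e::euclidean_space \<Rightarrow> real"
  assumes f: "sq_norm_on UNIV f" and sm: "smooth_on (- {0}) f" and "v \<noteq> 0"
  shows "pos_def_hessian f v"
  unfolding pos_def_hessian_def
proof (intro allI impI)
  fix w :: 'e assume "w \<noteq> 0"
  obtain \<beta> where b: "sq_norm_with UNIV f \<beta>" using f sq_norm_on_def by blast
  define D where "D z u = frechet_derivative f (at z) u" for z u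
  have D: "(f has_derivative D z) (at z)" if "z \<noteq> 0" for z
    using smooth_on_has_derivative[OF sm] that unfolding D_def[abs_def] by simp
  have D2: "((\<lambda>z. D z u) has_derivative frechet_derivative (\<lambda>z. D z u) (at z)) (at z)"
    if "z \<noteq> 0" for z u
    using smooth_on_has_derivative[OF smooth_on_frechet_derivative[OF sm]] that
    unfolding D_def[abs_def] by simp
  define m where "m = frechet_derivative (\<lambda>z. D z w) (at v) w"
  \<comment> \<open>Bilinearity: the index \<open>j\<close> is summed inside the outer derivative,
    as an identity valid near \<open>v\<close>, and then the outer derivative is expanded over
    \<open>i\<close>.\<close>
  have hm: "(\<Sum>i\<in>Basis. \<Sum>j\<in>Basis. (w \<bullet> i) * hessian f v i j * (w \<bullet> j)) = m"
  proof -
    let ?H = "\<lambda>j. frechet_derivative (\<lambda>z. D z j) (at v)"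
    have "((\<lambda>z. \<Sum>j\<in>Basis. (w \<bullet> j) *\<^sub>R D z j) has_derivative
        (\<lambda>u. \<Sum>j\<in>Basis. (w \<bullet> j) *\<^sub>R ?H j u)) (at v)"
      by (intro has_derivative_sum has_derivative_scaleR_right D2 \<open>v \<noteq> 0\<close>)
    then have "((\<lambda>z. D z w) has_derivative (\<lambda>u. \<Sum>j\<in>Basis. (w \<bullet> j) *\<^sub>R ?H j u)) (at v)"
    proof (rule has_derivative_transform_within_open[where s = "- {0}"])
      fix z :: 'e assume "z \<in> - {0}"
      then have "linear (D z)" using D has_derivative_linear by auto
      then show "(\<Sum>j\<in>Basis. (w \<bullet> j) *\<^sub>R D z j) = D z w"
        by (rule linear_eq_sum_Basis[symmetric])
    qed (use \<open>v \<noteq> 0\<close> in auto)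
    from frechet_derivative_at[OF this] have "m = (\<Sum>j\<in>Basis. (w \<bullet> j) *\<^sub>R ?H j w)"
      unfolding m_def by (rule fun_cong[OF sym])
    also have "\<dots> = (\<Sum>j\<in>Basis. (w \<bullet> j) * (\<Sum>i\<in>Basis. (w \<bullet> i) * ?H j i))"
    proof (rule sum.cong[OF refl])
      fix j :: 'e
      have "linear (?H j)" using D2[OF \<open>v \<noteq> 0\<close>] has_derivative_linear by blast
      then have "?H j w = (\<Sum>i\<in>Basis. (w \<bullet> i) *\<^sub>R ?H j i)"
        by (rule linear_eq_sum_Basis)
      then show "(w \<bullet> j) *\<^sub>R ?H j w = (w \<bullet> j) * (\<Sum>i\<in>Basis. (w \<bullet> i) * ?H j i)" by simp
    qed
    also have "\<dots> = (\<Sum>j\<in>Basis. \<Sum>i\<in>Basis. (w \<bullet> i) * hessian f v i j * (w \<bullet> j))"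
      by (simp add: hessian_def D_def sum_distrib_left mult_ac)
    also have "\<dots> = (\<Sum>i\<in>Basis. \<Sum>j\<in>Basis. (w \<bullet> i) * hessian f v i j * (w \<bullet> j))"
      by (rule sum.swap)
    finally show ?thesis by simp
  qed
  have "2 * \<beta> w \<le> m"
  proof (rule ccontr)
    assume "\<not> 2 * \<beta> w \<le> m"
    \<comment> \<open>The second difference minus its lower bound. It is nonnegative, but k(0) =
      k'(0) = 0 and k''(0) = 2m - 4 \<beta>(w), negative by assumption, push it below 0 immediately
      to the right of 0.\<close>
    define k where "k s = f (v + s *\<^sub>R w) + f (v + (- s) *\<^sub>R w) - 2 * f v - 2 * \<beta> w * s\<^sup>2" for s
    define k' where "k' s = D (v + s *\<^sub>R w) w - D (v + (- s) *\<^sub>R w) w - 4 * \<beta> w * s" for s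
    have k0: "0 \<le> k s" for s
    proof -
      have "(1 - 1/2) *\<^sub>R (v + s *\<^sub>R w) + (1/2) *\<^sub>R (v + (- s) *\<^sub>R w) = v"
        by (simp add: algebra_simps flip: scaleR_add_left)
      moreover have "(v + s *\<^sub>R w) - (v + (- s) *\<^sub>R w) = (2 * s) *\<^sub>R w"
        by (simp add: scaleR_2 flip: scaleR_scaleR)
      ultimately have "f v \<le> (1 - 1/2) * f (v + s *\<^sub>R w) + 1/2 * f (v + (- s) *\<^sub>R w)
          - 1/2 * (1 - 1/2) * \<beta> ((2 * s) *\<^sub>R w)"
        using sq_norm_with_convex[OF b, of "v + s *\<^sub>R w" "v + (- s) *\<^sub>R w" "1/2"] by simp
      then show ?thesis unfolding k_def sq_norm_with_scale[OF b UNIV_I]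
        by (simp add: power_mult_distrib field_simps)
    qed
    have line: "((\<lambda>s. v + s *\<^sub>R w) has_derivative (\<lambda>h. h *\<^sub>R w)) (at s)"
      "((\<lambda>s. v + (- s) *\<^sub>R w) has_derivative (\<lambda>h. (- h) *\<^sub>R w)) (at s)" for s
      by (auto intro!: derivative_eq_intros)
    \<comment> \<open>For \<open>\<bar>s\<bar> < e\<close> the line through \<open>v\<close> avoids
      the origin, the only point where \<open>f\<close> may fail to be differentiable.\<close>
    define e where "e = norm v / norm w"
    have "e > 0" using \<open>v \<noteq> 0\<close> \<open>w \<noteq> 0\<close> by (simp add: e_def)
    have ne: "v + s *\<^sub>R w \<noteq> 0" if "\<bar>s\<bar> < e" for s
    proof
      assume "v + s *\<^sub>R w = 0"
      then have "norm v = \<bar>s\<bar> * norm w" by (metis add.inverse_unique norm_minus_cancel norm_scaleR)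
      with that \<open>w \<noteq> 0\<close> show False by (simp add: e_def)
    qed
    have kd: "(k has_real_derivative k' s) (at s)" if "\<bar>s\<bar> < e" for s
    proof -
      have n: "v + s *\<^sub>R w \<noteq> 0" "v + (- s) *\<^sub>R w \<noteq> 0" using ne[of s] ne[of "-s"] that by auto
      have l: "linear (D (v + s *\<^sub>R w))" "linear (D (v + (- s) *\<^sub>R w))"
        using D n has_derivative_linear by blast+
      have "((\<lambda>s. f (v + s *\<^sub>R w)) has_derivative (\<lambda>h. D (v + s *\<^sub>R w) (h *\<^sub>R w))) (at s)"
        "((\<lambda>s. f (v + (- s) *\<^sub>R w)) has_derivative (\<lambda>h. D (v + (- s) *\<^sub>R w) ((- h) *\<^sub>R w))) (at s)"
        using has_derivative_compose[OF line(1) D[OF n(1)]] has_derivative_compose[OF line(2) D[OF n(2)]]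
        by auto
      then have "((\<lambda>s. f (v + s *\<^sub>R w)) has_real_derivative D (v + s *\<^sub>R w) w) (at s)"
        "((\<lambda>s. f (v + (- s) *\<^sub>R w)) has_real_derivative - D (v + (- s) *\<^sub>R w) w) (at s)"
        by (auto intro!: has_derivative_imp_has_field_derivative
            simp: linear_scale[OF l(1)] linear_scale[OF l(2)[simplified]] linear_neg[OF l(2)[simplified]])
      then show ?thesis
        unfolding k_def[abs_def] k'_def
        by (auto intro!: derivative_eq_intros)
    qed
    have "(k' has_real_derivative 2 * m - 4 * \<beta> w) (at 0)"
    proof -
      have l: "linear (frechet_derivative (\<lambda>z. D z w) (at v))"
        using D2[OF \<open>v \<noteq> 0\<close>] has_derivative_linear by blast
      \<comment> \<open>The base point is written as \<open>v + c *\<^sub>R w\<close> to match what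
        the chain rule expects at s = 0; \<open>c\<close> becomes \<open>0\<close> for the first
        line and \<open>- 0\<close> for the second.\<close>
      have *: "((\<lambda>z. D z w) has_derivative frechet_derivative (\<lambda>z. D z w) (at v)) (at (v + c *\<^sub>R w))"
        if "c = 0" for c
        using D2[OF \<open>v \<noteq> 0\<close>] that by simp
      have "((\<lambda>s. D (v + s *\<^sub>R w) w) has_derivative (\<lambda>h. frechet_derivative (\<lambda>z. D z w) (at v) (h *\<^sub>R w))) (at 0)"
        "((\<lambda>s. D (v + (- s) *\<^sub>R w) w) has_derivative (\<lambda>h. frechet_derivative (\<lambda>z. D z w) (at v) ((- h) *\<^sub>R w))) (at 0)"
        using has_derivative_compose[OF line(1) *] has_derivative_compose[OF line(2) *] by auto
      then have "((\<lambda>s. D (v + s *\<^sub>R w) w) has_real_derivative m) (at 0)"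
        "((\<lambda>s. D (v + (- s) *\<^sub>R w) w) has_real_derivative - m) (at 0)"
        unfolding m_def
        by (auto intro!: has_derivative_imp_has_field_derivative simp: linear_scale[OF l] linear_neg[OF l])
      then show ?thesis
        unfolding k'_def[abs_def]
        by (auto intro!: derivative_eq_intros)
    qed
    moreover have "2 * m - 4 * \<beta> w < 0" using \<open>\<not> 2 * \<beta> w \<le> m\<close> by simp
    ultimately obtain d where "d > 0" and d: "\<And>h. 0 < h \<Longrightarrow> h < d \<Longrightarrow> k' (0 + h) < k' 0"
      using DERIV_neg_dec_right by blast
    have k'0: "k' 0 = 0" by (simp add: k'_def)
    define h where "h = min d e / 2"
    have h: "0 < h" "h < d" "h < e" using \<open>d > 0\<close> \<open>e > 0\<close> by (auto simp: h_def)
    have "\<exists>z>0. z < h \<and> k h - k 0 = (h - 0) * k' z"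
      by (rule MVT2[OF h(1)]) (use h kd in auto)
    then obtain z where "0 < z" "z < h" "k h - k 0 = h * k' z" by auto
    moreover have "k' z < 0" using d[of z] k'0 h \<open>0 < z\<close> \<open>z < h\<close> by simp
    moreover have "k 0 = 0" by (simp add: k_def)
    ultimately have "k h < 0" using h by (simp add: mult_pos_neg)
    with k0[of h] show False by simp
  qed
  then show "0 < (\<Sum>i\<in>Basis. \<Sum>j\<in>Basis. (w \<bullet> i) * hessian f v i j * (w \<bullet> j))"
    using sq_norm_with_pos[OF b UNIV_I \<open>w \<noteq> 0\<close>] hm by simp
qed

section \<open>Smooth maximum\<close>

text \<open>
  For \<open>\<epsilon> = 0\<close> this is the maximum \<open>(a + b + \<bar>a - b\<bar>) / 2\<close>. The term \<open>\<epsilon> * (a + b)\<close> keeps the argument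
  of the modulus away from \<open>0\<close>, without spoiling homogeneity.
\<close>

definition smax :: "real \<Rightarrow> real \<Rightarrow> real \<Rightarrow> real" where
  "smax \<epsilon> a b = (a + b + cmod (Complex (sqrt (1 - \<epsilon>\<^sup>2) * (a - b)) (\<epsilon> * (a + b)))) / 2"

lemma smax_scale: "0 \<le> s \<Longrightarrow> smax \<epsilon> (s * a) (s * b) = s * smax \<epsilon> a b"
proof -
  assume "0 \<le> s"
  have "Complex (sqrt (1 - \<epsilon>\<^sup>2) * (s * a - s * b)) (\<epsilon> * (s * a + s * b))
      = s *\<^sub>R Complex (sqrt (1 - \<epsilon>\<^sup>2) * (a - b)) (\<epsilon> * (a + b))"
    by (simp add: complex_eq_iff algebra_simps)
  with \<open>0 \<le> s\<close> show ?thesis by (simp add: smax_def algebra_simps)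
qed

text \<open>The root in the smooth maximum is the Euclidean norm of a vector that is linear in (a,
  b), so this is the triangle inequality; \<open>Complex\<close> only serves as the plane.\<close>

lemma smax_add: "smax \<epsilon> (a + a') (b + b') \<le> smax \<epsilon> a b + smax \<epsilon> a' b'"
proof -
  have "Complex (sqrt (1 - \<epsilon>\<^sup>2) * (a + a' - (b + b'))) (\<epsilon> * (a + a' + (b + b')))
      = Complex (sqrt (1 - \<epsilon>\<^sup>2) * (a - b)) (\<epsilon> * (a + b)) + Complex (sqrt (1 - \<epsilon>\<^sup>2) * (a' - b')) (\<epsilon> * (a' + b'))"
    by (simp add: complex_eq_iff algebra_simps)
  then show ?thesis
    using norm_triangle_ineq[of "Complex (sqrt (1 - \<epsilon>\<^sup>2) * (a - b)) (\<epsilon> * (a + b))"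
        "Complex (sqrt (1 - \<epsilon>\<^sup>2) * (a' - b')) (\<epsilon> * (a' + b'))"]
    by (simp add: smax_def field_simps)
qed

context
  fixes \<epsilon> :: real
  assumes e: "0 \<le> \<epsilon>" "\<epsilon> \<le> 1"
begin

lemma sqrt_sq: "(sqrt (1 - \<epsilon>\<^sup>2))\<^sup>2 = 1 - \<epsilon>\<^sup>2"
  using e by (simp add: power_le_one)

lemma smax_eq: "smax \<epsilon> a b = (a + b + sqrt ((1 - \<epsilon>\<^sup>2) * (a - b)\<^sup>2 + \<epsilon>\<^sup>2 * (a + b)\<^sup>2)) / 2"
  by (simp add: smax_def cmod_def power_mult_distrib sqrt_sq)

text \<open>For nonnegative arguments |a - b| \<le> a + b, so trading a part of (a - b)^2 for the
  same part of (a + b)^2 can only enlarge the root.\<close>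

lemma smax_ge:
  assumes "0 \<le> a" "0 \<le> b"
  shows "a \<le> smax \<epsilon> a b" "b \<le> smax \<epsilon> a b"
proof -
  have "(a - b)\<^sup>2 \<le> (a + b)\<^sup>2" using assms by (simp add: power2_eq_square algebra_simps)
  then have "\<epsilon>\<^sup>2 * (a - b)\<^sup>2 \<le> \<epsilon>\<^sup>2 * (a + b)\<^sup>2" by (simp add: mult_left_mono)
  then have "(a - b)\<^sup>2 \<le> (1 - \<epsilon>\<^sup>2) * (a - b)\<^sup>2 + \<epsilon>\<^sup>2 * (a + b)\<^sup>2" by (simp add: algebra_simps)
  then have "\<bar>a - b\<bar> \<le> sqrt ((1 - \<epsilon>\<^sup>2) * (a - b)\<^sup>2 + \<epsilon>\<^sup>2 * (a + b)\<^sup>2)"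
    by (metis real_sqrt_abs real_sqrt_le_mono)
  then show "a \<le> smax \<epsilon> a b" "b \<le> smax \<epsilon> a b" unfolding smax_eq by auto
qed

text \<open>One component of the vector is at most |a - b| and accounts for the exact maximum; the
  other is at most 2 \<epsilon> c and is the whole overshoot.\<close>

lemma smax_le:
  assumes "0 \<le> a" "0 \<le> b" "a \<le> c" "b \<le> c"
  shows "smax \<epsilon> a b \<le> (1 + \<epsilon>) * c"
proof -
  have "cmod (Complex (sqrt (1 - \<epsilon>\<^sup>2) * (a - b)) (\<epsilon> * (a + b)))
      \<le> \<bar>sqrt (1 - \<epsilon>\<^sup>2) * (a - b)\<bar> + \<bar>\<epsilon> * (a + b)\<bar>"
    using cmod_le[of "Complex (sqrt (1 - \<epsilon>\<^sup>2) * (a - b)) (\<epsilon> * (a + b))"] by simp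
  moreover have "\<bar>sqrt (1 - \<epsilon>\<^sup>2) * (a - b)\<bar> \<le> \<bar>a - b\<bar>"
    using e by (simp add: abs_mult mult_left_le_one_le power_le_one)
  moreover have "\<bar>\<epsilon> * (a + b)\<bar> \<le> \<epsilon> * (2 * c)"
    using e assms by (simp add: abs_mult mult_left_mono)
  ultimately have "smax \<epsilon> a b \<le> (a + b + \<bar>a - b\<bar> + \<epsilon> * (2 * c)) / 2" by (simp add: smax_def)
  also have "\<dots> \<le> (1 + \<epsilon>) * c" using assms by (auto simp: abs_if algebra_simps)
  finally show ?thesis .
qed

text \<open>A sublinear function is monotone once it is nonpositive on the negative coordinate axes.
  Here it even vanishes there, because the two coefficients under the root add up to 1.\<close>

lemma smax_mono:
  assumes "a \<le> a'" "b \<le> b'"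
  shows "smax \<epsilon> a b \<le> smax \<epsilon> a' b'"
proof -
  have 1: "smax \<epsilon> (- h) 0 \<le> 0" "smax \<epsilon> 0 (- h) \<le> 0" if "0 \<le> h" for h
  proof -
    have "(1 - \<epsilon>\<^sup>2) * h\<^sup>2 + \<epsilon>\<^sup>2 * h\<^sup>2 = h\<^sup>2" by (simp add: algebra_simps)
    then show "smax \<epsilon> (- h) 0 \<le> 0" "smax \<epsilon> 0 (- h) \<le> 0" using that unfolding smax_eq by auto
  qed
  have "smax \<epsilon> a b \<le> smax \<epsilon> a' b + smax \<epsilon> (- (a' - a)) 0"
    using smax_add[of \<epsilon> a' "- (a' - a)" b 0] by simp
  also have "\<dots> \<le> smax \<epsilon> a' b" using 1(1)[of "a' - a"] assms by simp
  also have "\<dots> \<le> smax \<epsilon> a' b' + smax \<epsilon> 0 (- (b' - b))"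
    using smax_add[of \<epsilon> a' 0 b' "- (b' - b)"] by simp
  also have "\<dots> \<le> smax \<epsilon> a' b'" using 1(2)[of "b' - b"] assms by simp
  finally show ?thesis .
qed

text \<open>A common shift leaves a - b unchanged, and it lowers (a + b)^2 as long as both arguments
  stay nonnegative.\<close>

lemma smax_diff_le:
  assumes "0 \<le> h" "h \<le> a" "h \<le> b"
  shows "smax \<epsilon> (a - h) (b - h) \<le> smax \<epsilon> a b - h"
proof -
  have "(a - h + (b - h))\<^sup>2 \<le> (a + b)\<^sup>2" using assms by (intro power_mono) auto
  then have "\<epsilon>\<^sup>2 * (a - h + (b - h))\<^sup>2 \<le> \<epsilon>\<^sup>2 * (a + b)\<^sup>2" by (simp add: mult_left_mono)
  then have "sqrt ((1 - \<epsilon>\<^sup>2) * (a - h - (b - h))\<^sup>2 + \<epsilon>\<^sup>2 * (a - h + (b - h))\<^sup>2)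
     \<le> sqrt ((1 - \<epsilon>\<^sup>2) * (a - b)\<^sup>2 + \<epsilon>\<^sup>2 * (a + b)\<^sup>2)" by simp
  then show ?thesis unfolding smax_eq by (simp add: field_simps)
qed

lemma sq_norm_on_smax:
  assumes V: "subspace V" and p: "sq_norm_on V p" and q: "sq_norm_on V q"
  shows "sq_norm_on V (\<lambda>v. smax \<epsilon> (p v) (q v))"
proof -
  obtain \<beta> \<gamma> where b: "sq_norm_with V p \<beta>" and c: "sq_norm_with V q \<gamma>"
    using p q sq_norm_on_def by blast
  \<comment> \<open>With the smaller of the two moduli both convexity inequalities gain the same
    \<open>h\<close>, a common shift that can be moved out of the smooth maximum.\<close>
  define \<delta> where "\<delta> v = min (\<beta> v) (\<gamma> v)" for v
  have "smax \<epsilon> (p ((1 - t) *\<^sub>R v + t *\<^sub>R w)) (q ((1 - t) *\<^sub>R v + t *\<^sub>R w))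
      \<le> (1 - t) * smax \<epsilon> (p v) (q v) + t * smax \<epsilon> (p w) (q w) - t * (1 - t) * \<delta> (v - w)"
    if vw: "v \<in> V" "w \<in> V" "0 \<le> t" "t \<le> 1" for v w t
  proof -
    let ?m = "(1 - t) *\<^sub>R v + t *\<^sub>R w"
    define h where "h = t * (1 - t) * \<delta> (v - w)"
    have d: "v - w \<in> V" using V vw by (simp add: subspace_diff)
    have m: "?m \<in> V" using V vw by (simp add: subspace_add subspace_scale)
    have h0: "0 \<le> h" using vw sq_norm_with_nonneg[OF b d] sq_norm_with_nonneg[OF c d] by (simp add: h_def \<delta>_def)
    have h1: "h \<le> t * (1 - t) * \<beta> (v - w)" "h \<le> t * (1 - t) * \<gamma> (v - w)"
      using vw by (auto simp: h_def \<delta>_def intro!: mult_left_mono)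
    have p': "p ?m \<le> (1 - t) * p v + t * p w - h" and q': "q ?m \<le> (1 - t) * q v + t * q w - h"
      using sq_norm_with_convex[OF b vw] sq_norm_with_convex[OF c vw] h1 by linarith+
    have "0 \<le> p ?m" "0 \<le> q ?m" using sq_norm_on_nonneg[OF p V m] sq_norm_on_nonneg[OF q V m] .
    \<comment> \<open>The shifted arguments dominate \<open>p ?m\<close> and \<open>q ?m\<close>,
      hence are nonnegative, as \<open>smax_diff_le\<close> demands.\<close>
    then have le: "h \<le> (1 - t) * p v + t * p w" "h \<le> (1 - t) * q v + t * q w" using p' q' by linarith+
    have "smax \<epsilon> (p ?m) (q ?m) \<le> smax \<epsilon> ((1 - t) * p v + t * p w - h) ((1 - t) * q v + t * q w - h)"
      by (rule smax_mono[OF p' q'])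
    also have "\<dots> \<le> smax \<epsilon> ((1 - t) * p v + t * p w) ((1 - t) * q v + t * q w) - h"
      by (rule smax_diff_le[OF h0 le])
    also have "\<dots> \<le> smax \<epsilon> ((1 - t) * p v) ((1 - t) * q v) + smax \<epsilon> (t * p w) (t * q w) - h"
      using smax_add by simp
    also have "\<dots> = (1 - t) * smax \<epsilon> (p v) (q v) + t * smax \<epsilon> (p w) (q w) - h"
      using vw by (simp add: smax_scale)
    finally show ?thesis by (simp add: h_def)
  qed
  moreover have "\<delta> (a *\<^sub>R v) = a\<^sup>2 * \<delta> v" if "v \<in> V" for v a
    using that by (simp add: \<delta>_def sq_norm_with_scale[OF b] sq_norm_with_scale[OF c] min_mult_distrib_left)
  moreover have "0 < \<delta> v" if "v \<in> V" "v \<noteq> 0" for v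
    using that sq_norm_with_pos[OF b] sq_norm_with_pos[OF c] by (simp add: \<delta>_def)
  moreover have "smax \<epsilon> (p (a *\<^sub>R v)) (q (a *\<^sub>R v)) = a\<^sup>2 * smax \<epsilon> (p v) (q v)" if "v \<in> V" for v a
    using that by (simp add: sq_norm_on_scale[OF p] sq_norm_on_scale[OF q] smax_scale)
  ultimately have "sq_norm_with V (\<lambda>v. smax \<epsilon> (p v) (q v)) \<delta>"
    by (intro sq_norm_withI) auto
  then show ?thesis using sq_norm_on_def by blast
qed

lemma continuous_on_smax:
  "continuous_on S f \<Longrightarrow> continuous_on S g \<Longrightarrow> continuous_on S (\<lambda>x. smax \<epsilon> (f x) (g x))"
  unfolding smax_eq by (intro continuous_intros) auto

lemma smooth_on_smax:
  assumes "0 < \<epsilon>" "open S" "smooth_on S f" "smooth_on S g" "\<And>x. x \<in> S \<Longrightarrow> 0 < f x" "\<And>x. x \<in> S \<Longrightarrow> 0 < g x"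
  shows "smooth_on S (\<lambda>x. smax \<epsilon> (f x) (g x))"
proof -
  let ?r = "\<lambda>x. (1 - \<epsilon>\<^sup>2) * ((f x - g x) * (f x - g x)) + \<epsilon>\<^sup>2 * ((f x + g x) * (f x + g x))"
  have "0 < ?r x" if "x \<in> S" for x
    using assms(1) assms(5,6)[OF that] e
    by (intro add_nonneg_pos mult_nonneg_nonneg[OF _ zero_le_square] mult_pos_pos)
      (auto simp: power_le_one)
  then have "smooth_on S (\<lambda>x. (f x + g x + sqrt (?r x)) * (1/2))"
    by (intro smooth_on_mult smooth_on_add smooth_on_real_sqrt smooth_on_diff smooth_on_const assms)
  then show ?thesis unfolding smax_eq by (simp add: power2_eq_square)
qed

end

section \<open>Local representations on the tangent bundle\<close>

text \<open>Joint smoothness in point and vector is what transition maps of the tangent bundle need;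
  linearity in the vector reduces it to the fixed basis directions.\<close>

lemma smooth_on_derivative_bundle:
  fixes f :: "'a::euclidean_space \<Rightarrow> 'b::euclidean_space"
  assumes "open S" "smooth_on S f"
  shows "smooth_on (S \<times> UNIV) (\<lambda>(y, u). frechet_derivative f (at y) u)"
proof -
  have o: "open (S \<times> (UNIV :: 'a set))" using assms(1) by (simp add: open_Times)
  have "smooth_on (S \<times> UNIV) (\<lambda>p :: 'a \<times> 'a. frechet_derivative f (at (fst p)) b)" for b
    by (rule smooth_on_compose[OF o assms(1) smooth_on_bounded_linear[OF bounded_linear_fst]
          smooth_on_frechet_derivative[OF assms(2)]]) auto
  moreover have "smooth_on (S \<times> UNIV) (\<lambda>p :: 'a \<times> 'a. snd p \<bullet> b)" for b
    by (intro smooth_on_bounded_linear bounded_linear_inner_left_comp bounded_linear_snd)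
  ultimately have s: "smooth_on (S \<times> UNIV)
      (\<lambda>p. \<Sum>b\<in>Basis. (snd p \<bullet> b) *\<^sub>R frechet_derivative f (at (fst p)) b)"
    by (intro smooth_on_sum smooth_on_scaleR o)
  show ?thesis
  proof (rule smooth_on_cong[OF o _ s])
    fix p :: "'a \<times> 'a" assume "p \<in> S \<times> UNIV"
    then have "linear (frechet_derivative f (at (fst p)))"
      using smooth_on_has_derivative[OF assms(2)] has_derivative_linear by force
    from linear_eq_sum_Basis[OF this, of "snd p"]
    show "(\<Sum>b\<in>Basis. (snd p \<bullet> b) *\<^sub>R frechet_derivative f (at (fst p)) b)
        = (case p of (y, u) \<Rightarrow> frechet_derivative f (at y) u)"
      by (simp add: case_prod_beta)
  qed
qed

locale atlas =
  fixes \<A> :: "('a::{t2_space,second_countable_topology}, 'e::euclidean_space) chart set"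
  assumes smooth_atlas: "smooth_atlas \<A>"
begin

abbreviation chart_image :: "('a, 'e) chart \<Rightarrow> 'e set" where
  "chart_image c \<equiv> chart_map c ` chart_dom c"

abbreviation chart_inv :: "('a, 'e) chart \<Rightarrow> 'e \<Rightarrow> 'a" where
  "chart_inv c \<equiv> inv_into (chart_dom c) (chart_map c)"

lemma ex_chart: "\<exists>c\<in>\<A>. x \<in> chart_dom c"
  using smooth_atlas unfolding smooth_atlas_def by (metis UN_E UNIV_I)

lemma chart_homeomorphism:
  assumes "c \<in> \<A>"
  obtains g where "homeomorphism (chart_dom c) (chart_image c) (chart_map c) g"
proof -
  have "is_chart c" using smooth_atlas assms unfolding smooth_atlas_def by blast
  then show ?thesis unfolding is_chart_def using that by blast
qed

lemma open_chart_dom: "c \<in> \<A> \<Longrightarrow> open (chart_dom c)"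
  using smooth_atlas unfolding smooth_atlas_def is_chart_def by blast

lemma open_chart_image: "c \<in> \<A> \<Longrightarrow> open (chart_image c)"
  using smooth_atlas unfolding smooth_atlas_def is_chart_def by blast

lemma continuous_on_chart_map: "c \<in> \<A> \<Longrightarrow> continuous_on (chart_dom c) (chart_map c)"
  by (rule chart_homeomorphism) (auto simp: homeomorphism_def)

lemma inj_on_chart_map: "c \<in> \<A> \<Longrightarrow> inj_on (chart_map c) (chart_dom c)"
  by (rule chart_homeomorphism) (auto simp: homeomorphism_def intro: inj_on_inverseI)

lemma chart_inv_chart_map: "c \<in> \<A> \<Longrightarrow> x \<in> chart_dom c \<Longrightarrow> chart_inv c (chart_map c x) = x"
  by (simp add: inj_on_chart_map)

lemma chart_inv_in: "y \<in> chart_image c \<Longrightarrow> chart_inv c y \<in> chart_dom c"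
  by (rule inv_into_into)

lemma continuous_on_chart_inv: "c \<in> \<A> \<Longrightarrow> continuous_on (chart_image c) (chart_inv c)"
proof -
  assume c: "c \<in> \<A>"
  then obtain g where g: "homeomorphism (chart_dom c) (chart_image c) (chart_map c) g"
    by (rule chart_homeomorphism)
  have "g y = chart_inv c y" if "y \<in> chart_image c" for y
    using that chart_inv_chart_map[OF c] homeomorphism_apply1[OF g] by auto
  with homeomorphism_cont2[OF g] show ?thesis by (rule continuous_on_eq)
qed

lemma open_chart_map_image:
  assumes c: "c \<in> \<A>" and V: "open V" "V \<subseteq> chart_dom c"
  shows "open (chart_map c ` V)"
proof -
  have "chart_map c ` V = chart_image c \<inter> chart_inv c -` V"
    using V(2) chart_inv_chart_map[OF c] by (auto simp: subset_iff)
  then have "chart_map c ` V = chart_inv c -` V \<inter> chart_image c" by (simp add: Int_commute)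
  moreover have "open (chart_inv c -` V \<inter> chart_image c)"
    using V(1) continuous_on_chart_inv[OF c]
    by (intro continuous_on_open_vimage[THEN iffD1, rule_format] open_chart_image[OF c])
  ultimately show ?thesis by simp
qed

abbreviation overlap :: "('a, 'e) chart \<Rightarrow> ('a, 'e) chart \<Rightarrow> 'e set" where
  "overlap c d \<equiv> chart_map c ` (chart_dom c \<inter> chart_dom d)"

lemma open_overlap: "c \<in> \<A> \<Longrightarrow> d \<in> \<A> \<Longrightarrow> open (overlap c d)"
  by (intro open_chart_map_image) (auto intro: open_chart_dom)

lemma smooth_on_transition_map:
  "c \<in> \<A> \<Longrightarrow> d \<in> \<A> \<Longrightarrow> smooth_on (overlap c d) (transition_map c d)"
  using smooth_atlas unfolding smooth_atlas_def by blast

lemma transition_map_chart_map: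
  "c \<in> \<A> \<Longrightarrow> x \<in> chart_dom c \<Longrightarrow> transition_map c d (chart_map c x) = chart_map d x"
  by (simp add: transition_map_def chart_inv_chart_map)

section \<open>Jacobians of transition maps and coordinates of tangent vectors\<close>

definition jac :: "('a, 'e) chart \<Rightarrow> ('a, 'e) chart \<Rightarrow> 'a \<Rightarrow> 'e \<Rightarrow> 'e" where
  "jac c d x = frechet_derivative (transition_map c d) (at (chart_map c x))"

lemma has_derivative_transition_map:
  assumes "c \<in> \<A>" "d \<in> \<A>" "x \<in> chart_dom c" "x \<in> chart_dom d"
  shows "(transition_map c d has_derivative jac c d x) (at (chart_map c x))"
  unfolding jac_def
  by (rule smooth_on_has_derivative[OF smooth_on_transition_map[OF assms(1,2)]])
    (use assms in auto)

lemma linear_jac: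
  "c \<in> \<A> \<Longrightarrow> d \<in> \<A> \<Longrightarrow> x \<in> chart_dom c \<Longrightarrow> x \<in> chart_dom d \<Longrightarrow> linear (jac c d x)"
  using has_derivative_transition_map has_derivative_linear by blast

text \<open>The chain rule: on the open triple overlap the transition from \<open>c\<close> to
  \<open>e\<close> factors through \<open>d\<close>, and derivatives depend only on such a
  neighbourhood.\<close>

lemma jac_cocycle:
  assumes "c \<in> \<A>" "d \<in> \<A>" "e \<in> \<A>" "x \<in> chart_dom c" "x \<in> chart_dom d" "x \<in> chart_dom e"
  shows "jac d e x (jac c d x u) = jac c e x u"
proof -
  have "(transition_map d e has_derivative jac d e x) (at (transition_map c d (chart_map c x)))"
    using has_derivative_transition_map[OF assms(2,3,5,6)] assms by (simp add: transition_map_chart_map)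
  from has_derivative_compose[OF has_derivative_transition_map[OF assms(1,2,4,5)] this]
  have "((\<lambda>y. transition_map d e (transition_map c d y)) has_derivative
      (\<lambda>u. jac d e x (jac c d x u))) (at (chart_map c x))" .
  then have "(transition_map c e has_derivative (\<lambda>u. jac d e x (jac c d x u))) (at (chart_map c x))"
  proof (rule has_derivative_transform_within_open)
    show "open (chart_map c ` (chart_dom c \<inter> chart_dom d \<inter> chart_dom e))"
      using assms by (intro open_chart_map_image) (auto intro: open_chart_dom)
  qed (use assms in \<open>auto simp: transition_map_chart_map\<close>)
  from has_derivative_unique[OF this has_derivative_transition_map[OF assms(1,3,4,6)]]
  show ?thesis by (rule fun_cong)
qed

lemma jac_self:
  assumes "c \<in> \<A>" "x \<in> chart_dom c"
  shows "jac c c x u = u"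
proof -
  have "((\<lambda>y. y) has_derivative (\<lambda>u. u)) (at (chart_map c x))" by simp
  then have "(transition_map c c has_derivative (\<lambda>u. u)) (at (chart_map c x))"
    by (rule has_derivative_transform_within_open[OF _ open_chart_image[OF assms(1)]])
      (use assms in \<open>auto simp: transition_map_chart_map\<close>)
  from has_derivative_unique[OF this has_derivative_transition_map[OF assms(1,1,2,2)]]
  have "jac c c x = (\<lambda>u. u)" by (rule sym)
  then show ?thesis by simp
qed

text \<open>An explicit inverse of taking the coordinate in \<open>c\<close>: the coordinate
  \<open>u\<close> is carried to every other chart by its Jacobian, consistently by
  \<open>jac_cocycle\<close>. The value 0 is the normalisation in
  \<open>tangent_space\<close>.\<close>

definition tvec :: "('a, 'e) chart \<Rightarrow> 'a \<Rightarrow> 'e \<Rightarrow> ('a, 'e) tvec" where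
  "tvec c x u = (\<lambda>d. if d \<in> \<A> \<and> x \<in> chart_dom d then jac c d x u else 0)"

lemma tvec_apply: "d \<in> \<A> \<Longrightarrow> x \<in> chart_dom d \<Longrightarrow> tvec c x u d = jac c d x u"
  by (simp add: tvec_def)

lemma tvec_in_tangent_space:
  "c \<in> \<A> \<Longrightarrow> x \<in> chart_dom c \<Longrightarrow> tvec c x u \<in> tangent_space \<A> x"
  unfolding tangent_space_def by (auto simp: tvec_def jac_cocycle jac_def[symmetric])

lemma tvec_self: "c \<in> \<A> \<Longrightarrow> x \<in> chart_dom c \<Longrightarrow> tvec c x u c = u"
  by (simp add: tvec_def jac_self)

lemma tangent_space_transform:
  "v \<in> tangent_space \<A> x \<Longrightarrow> c \<in> \<A> \<Longrightarrow> d \<in> \<A> \<Longrightarrow> x \<in> chart_dom c \<Longrightarrow> x \<in> chart_dom d \<Longrightarrow>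
    v d = jac c d x (v c)"
  unfolding tangent_space_def jac_def by blast

lemma tvec_eq:
  assumes "v \<in> tangent_space \<A> x" "c \<in> \<A>" "x \<in> chart_dom c"
  shows "tvec c x (v c) = v"
proof
  fix d
  show "tvec c x (v c) d = v d"
  proof (cases "d \<in> \<A> \<and> x \<in> chart_dom d")
    case True
    then show ?thesis using tangent_space_transform[OF assms(1,2) _ assms(3)] by (simp add: tvec_def)
  next
    case False
    moreover have "v d = 0" using False assms(1) unfolding tangent_space_def by blast
    ultimately show ?thesis by (auto simp: tvec_def)
  qed
qed

lemma linear_tvec:
  assumes "c \<in> \<A>" "x \<in> chart_dom c"
  shows "linear (tvec c x)"
  by (rule linearI)
    (auto simp: tvec_def fun_eq_iff scaleR_fun_def linear_add[OF linear_jac] linear_scale[OF linear_jac]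
      assms)

lemma subspace_tangent_space: "subspace (tangent_space \<A> x)"
proof -
  obtain c where c: "c \<in> \<A>" "x \<in> chart_dom c" using ex_chart by blast
  have "tangent_space \<A> x = tvec c x ` UNIV"
    using tvec_in_tangent_space[OF c] tvec_eq[OF _ c] by (auto simp: image_iff) metis
  then show ?thesis using linear_subspace_image[OF linear_tvec[OF c]] subspace_UNIV by metis
qed

lemma tvec_eq_0_iff: "c \<in> \<A> \<Longrightarrow> x \<in> chart_dom c \<Longrightarrow> tvec c x u = 0 \<longleftrightarrow> u = 0"
  using tvec_self[of c x u] linear_0[OF linear_tvec[of c x]] by (metis zero_fun_apply)

lemma tangent_vector_eq:
  assumes "c \<in> \<A>" "x \<in> chart_dom c"
  shows "tangent_vector \<A> x c u = tvec c x u"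
  unfolding tangent_vector_def
  by (rule inv_into_f_eq)
    (auto intro!: inj_onI simp: tvec_in_tangent_space tvec_self assms, metis tvec_eq assms)

text \<open>The inverse of the chart \<open>tangent_chart c\<close> of the tangent bundle.\<close>

definition pt :: "('a, 'e) chart \<Rightarrow> 'e \<times> 'e \<Rightarrow> 'a \<times> ('a, 'e) tvec" where
  "pt c = (\<lambda>(y, u). (chart_inv c y, tvec c (chart_inv c y) u))"

lemma pt_chart_map: "c \<in> \<A> \<Longrightarrow> x \<in> chart_dom c \<Longrightarrow> pt c (chart_map c x, u) = (x, tvec c x u)"
  by (simp add: pt_def chart_inv_chart_map)

lemma pt_tangent_chart:
  assumes "c \<in> \<A>" "p \<in> tangent_chart_dom \<A> c"
  shows "pt c (tangent_chart c p) = p"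
  using assms by (auto simp: tangent_chart_dom_def tangent_chart_def pt_chart_map tvec_eq)

lemma pt_in: "c \<in> \<A> \<Longrightarrow> p \<in> chart_image c \<times> UNIV \<Longrightarrow> pt c p \<in> tangent_chart_dom \<A> c"
  by (auto simp: tangent_chart_dom_def pt_chart_map tvec_in_tangent_space)

lemma tangent_chart_pt: "c \<in> \<A> \<Longrightarrow> p \<in> chart_image c \<times> UNIV \<Longrightarrow> tangent_chart c (pt c p) = p"
  by (auto simp: tangent_chart_def pt_chart_map tvec_self)

lemma tangent_chart_in: "p \<in> tangent_chart_dom \<A> c \<Longrightarrow> tangent_chart c p \<in> chart_image c \<times> UNIV"
  by (auto simp: tangent_chart_dom_def tangent_chart_def)

lemma inv_into_tangent_chart:
  assumes "c \<in> \<A>" "p \<in> chart_image c \<times> UNIV"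
  shows "inv_into (tangent_chart_dom \<A> c) (tangent_chart c) p = pt c p"
  by (rule inv_into_f_eq)
    (use assms pt_in tangent_chart_pt in \<open>auto intro!: inj_onI dest: arg_cong[of _ _ "pt c"] simp: pt_tangent_chart\<close>)

section \<open>Topology and smooth functions of the tangent bundle, read in charts\<close>

definition tangent_transition :: "('a, 'e) chart \<Rightarrow> ('a, 'e) chart \<Rightarrow> 'e \<times> 'e \<Rightarrow> 'e \<times> 'e" where
  "tangent_transition c d = (\<lambda>(y, u). (transition_map c d y, frechet_derivative (transition_map c d) (at y) u))"

lemma smooth_on_tangent_transition:
  assumes "c \<in> \<A>" "d \<in> \<A>"
  shows "smooth_on (overlap c d \<times> UNIV) (tangent_transition c d)"
proof -
  have o: "open (overlap c d \<times> (UNIV :: 'e set))"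
    using open_overlap[OF assms] by (simp add: open_Times)
  have "smooth_on (overlap c d \<times> UNIV) (\<lambda>p :: 'e \<times> 'e. transition_map c d (fst p))"
    by (rule smooth_on_compose[OF o open_overlap[OF assms]
          smooth_on_bounded_linear[OF bounded_linear_fst] smooth_on_transition_map[OF assms]]) auto
  from smooth_on_Pair[OF o this smooth_on_derivative_bundle[OF open_overlap[OF assms] smooth_on_transition_map[OF assms]]]
  show ?thesis by (simp add: tangent_transition_def case_prod_beta')
qed

lemma tangent_transition_chart_map:
  "c \<in> \<A> \<Longrightarrow> x \<in> chart_dom c \<Longrightarrow>
    tangent_transition c d (chart_map c x, u) = (chart_map d x, jac c d x u)"
  by (simp add: tangent_transition_def transition_map_chart_map jac_def)

lemma tangent_chart_pt_overlap:
  assumes "c \<in> \<A>" "d \<in> \<A>" "p \<in> overlap c d \<times> UNIV"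
  shows "tangent_chart d (pt c p) = tangent_transition c d p"
  using assms by (auto simp: tangent_chart_def pt_chart_map tangent_transition_chart_map tvec_apply)

lemma pt_in_tangent_chart_dom_iff:
  assumes "c \<in> \<A>" "p \<in> chart_image c \<times> UNIV"
  shows "pt c p \<in> tangent_chart_dom \<A> d \<longleftrightarrow> p \<in> overlap c d \<times> UNIV"
  using assms inj_on_chart_map[OF assms(1)]
  by (auto simp: tangent_chart_dom_def pt_chart_map tvec_in_tangent_space inj_on_def)

lemma open_chart_image_Times: "c \<in> \<A> \<Longrightarrow> open (chart_image c \<times> (UNIV :: 'e set))"
  by (simp add: open_Times open_chart_image)

text \<open>In effect continuity of \<open>pt c\<close>. For a generating set, given by a chart
  \<open>d\<close>, the preimage is the preimage of an open set under the continuous transition from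
  \<open>c\<close> to \<open>d\<close>; unions and finite intersections follow by induction.\<close>

lemma open_pt_vimage:
  assumes "openin (tangent_topology \<A>) W" "c \<in> \<A>"
  shows "open {p \<in> chart_image c \<times> UNIV. pt c p \<in> W}"
proof -
  have "generate_topology_on {{p \<in> tangent_chart_dom \<A> c. tangent_chart c p \<in> S} | c S. c \<in> \<A> \<and> open S} W"
    using assms(1) by (simp add: tangent_topology_def openin_topology_generated_by_iff)
  then show ?thesis
  proof induction
    case Empty
    then show ?case by simp
  next
    case (Int a b)
    have "{p \<in> chart_image c \<times> UNIV. pt c p \<in> a \<inter> b} =
        {p \<in> chart_image c \<times> UNIV. pt c p \<in> a} \<inter> {p \<in> chart_image c \<times> UNIV. pt c p \<in> b}" by blast
    then show ?case using Int.IH by (simp only: open_Int)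
  next
    case (UN K)
    have "{p \<in> chart_image c \<times> UNIV. pt c p \<in> \<Union>K} = (\<Union>k\<in>K. {p \<in> chart_image c \<times> UNIV. pt c p \<in> k})"
      by blast
    moreover have "open (\<Union>k\<in>K. {p \<in> chart_image c \<times> UNIV. pt c p \<in> k})"
      by (intro open_UN ballI UN.IH)
    ultimately show ?case by simp
  next
    case (Basis s)
    then obtain d S where s: "s = {p \<in> tangent_chart_dom \<A> d. tangent_chart d p \<in> S}" "d \<in> \<A>" "open S"
      by blast
    have o: "open (overlap c d \<times> (UNIV :: 'e set))"
      using open_overlap assms(2) s(2) by (simp add: open_Times)
    have sub: "overlap c d \<times> UNIV \<subseteq> chart_image c \<times> UNIV" by auto
    have "p \<in> chart_image c \<times> UNIV \<and> pt c p \<in> s \<longleftrightarrow> p \<in> tangent_transition c d -` S \<inter> (overlap c d \<times> UNIV)"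
      for p
    proof (cases "p \<in> overlap c d \<times> UNIV")
      case True
      then have "p \<in> chart_image c \<times> UNIV" using sub by blast
      with True show ?thesis
        using pt_in_tangent_chart_dom_iff[OF assms(2), of p d]
          tangent_chart_pt_overlap[OF assms(2) s(2) True] by (simp add: s(1))
    next
      case False
      then show ?thesis
        using pt_in_tangent_chart_dom_iff[OF assms(2), of p d] by (auto simp: s(1))
    qed
    then have "{p \<in> chart_image c \<times> UNIV. pt c p \<in> s} = tangent_transition c d -` S \<inter> (overlap c d \<times> UNIV)"
      by blast
    moreover have "open (tangent_transition c d -` S \<inter> (overlap c d \<times> UNIV))"
      using smooth_on_imp_continuous_on[OF smooth_on_tangent_transition[OF assms(2) s(2)]] s(3)
      by (intro continuous_on_open_vimage[THEN iffD1, rule_format] o)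
    ultimately show ?case by simp
  qed
qed

lemma topspace_tangent_topology: "topspace (tangent_topology \<A>) = tangent_bundle \<A>"
proof -
  have "topspace (tangent_topology \<A>) =
      \<Union>{{p \<in> tangent_chart_dom \<A> c. tangent_chart c p \<in> S} | c S. c \<in> \<A> \<and> open S}"
    by (simp add: tangent_topology_def topology_generated_by_topspace)
  also have "\<dots> = (\<Union>c\<in>\<A>. tangent_chart_dom \<A> c)"
  proof (intro equalityI subsetI)
    fix p assume "p \<in> (\<Union>c\<in>\<A>. tangent_chart_dom \<A> c)"
    then obtain c where "c \<in> \<A>" "p \<in> {p \<in> tangent_chart_dom \<A> c. tangent_chart c p \<in> UNIV}" by blast
    then show "p \<in> \<Union>{{p \<in> tangent_chart_dom \<A> c. tangent_chart c p \<in> S} | c S. c \<in> \<A> \<and> open S}"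
      using open_UNIV by blast
  qed blast
  also have "\<dots> = tangent_bundle \<A>"
    using ex_chart by (auto simp: tangent_chart_dom_def tangent_bundle_def)
  finally show ?thesis .
qed

text \<open>The preimage of \<open>U\<close> is a union of generating sets: over each chart
  \<open>c\<close> it is given by the set \<open>?S c\<close> of coordinates, which is open by
  assumption.\<close>

lemma continuous_map_tangent_topology:
  fixes F :: "'a \<times> ('a, 'e) tvec \<Rightarrow> real"
  assumes "\<And>c. c \<in> \<A> \<Longrightarrow> continuous_on (chart_image c \<times> UNIV) (\<lambda>p. F (pt c p))"
  shows "continuous_map (tangent_topology \<A>) euclideanreal F"
  unfolding continuous_map topspace_tangent_topology
proof (intro conjI allI impI)
  fix U :: "real set" assume "openin euclideanreal U"
  then have U: "open U" by simp
  let ?S = "\<lambda>c. (\<lambda>p. F (pt c p)) -` U \<inter> (chart_image c \<times> UNIV)"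
  let ?B = "\<lambda>c. {p \<in> tangent_chart_dom \<A> c. tangent_chart c p \<in> ?S c}"
  have S: "open (?S c)" if "c \<in> \<A>" for c
    using assms[OF that] U
    by (intro continuous_on_open_vimage[THEN iffD1, rule_format] open_chart_image_Times[OF that])
  have B: "?B c = {p \<in> tangent_chart_dom \<A> c. F p \<in> U}" if "c \<in> \<A>" for c
  proof -
    have "p \<in> tangent_chart_dom \<A> c \<and> tangent_chart c p \<in> ?S c \<longleftrightarrow>
        p \<in> tangent_chart_dom \<A> c \<and> F p \<in> U" for p
      using pt_tangent_chart[OF that, of p] tangent_chart_in[of p c]
      by (cases "p \<in> tangent_chart_dom \<A> c") (simp_all del: mem_Times_iff)
    then show ?thesis by (rule Collect_cong)
  qed
  have "{p \<in> tangent_bundle \<A>. F p \<in> U} = (\<Union>c\<in>\<A>. ?B c)"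
  proof -
    have "(\<Union>c\<in>\<A>. ?B c) = (\<Union>c\<in>\<A>. {p \<in> tangent_chart_dom \<A> c. F p \<in> U})"
      by (rule SUP_cong[OF refl B])
    also have "\<dots> = {p \<in> tangent_bundle \<A>. F p \<in> U}"
      using ex_chart by (auto simp: tangent_chart_dom_def tangent_bundle_def)
    finally show ?thesis by (rule sym)
  qed
  moreover have "openin (tangent_topology \<A>) (?B c)" if "c \<in> \<A>" for c
    unfolding tangent_topology_def
    by (rule topology_generated_by_Basis) (rule CollectI, rule exI[of _ c],
        rule exI[of _ "?S c"], intro conjI refl S[OF that] that)
  then have "openin (tangent_topology \<A>) (\<Union>c\<in>\<A>. ?B c)"
    by (intro openin_Union) blast
  ultimately show "openin (tangent_topology \<A>) {p \<in> tangent_bundle \<A>. F p \<in> U}"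
    by simp
qed simp

definition smooth_TM :: "('a \<times> ('a, 'e) tvec \<Rightarrow> real) \<Rightarrow> bool" where
  "smooth_TM H \<longleftrightarrow> (\<forall>c\<in>\<A>. smooth_on (chart_image c \<times> UNIV) (\<lambda>p. H (pt c p)))"

text \<open>The regularity that the smooth maximum preserves: on the zero section the expression
  under its root vanishes, so that only continuity remains there.\<close>

definition smooth_TM0 :: "('a \<times> ('a, 'e) tvec \<Rightarrow> real) \<Rightarrow> bool" where
  "smooth_TM0 H \<longleftrightarrow> (\<forall>c\<in>\<A>. smooth_on (chart_image c \<times> (- {0})) (\<lambda>p. H (pt c p)) \<and>
     continuous_on (chart_image c \<times> UNIV) (\<lambda>p. H (pt c p)))"

lemma smooth_TM_imp_TM0: "smooth_TM H \<Longrightarrow> smooth_TM0 H"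
  unfolding smooth_TM_def smooth_TM0_def
  by (auto intro: smooth_on_imp_continuous_on elim!: smooth_on_subset)

lemma open_chart_image_Times0: "c \<in> \<A> \<Longrightarrow> open (chart_image c \<times> (- {0 :: 'e}))"
  by (simp add: open_Times open_chart_image open_Compl)

lemma sq_norm_pt_pos:
  assumes "\<And>x. sq_norm_on (tangent_space \<A> x) (\<lambda>v. Q (x, v))" "c \<in> \<A>" "p \<in> chart_image c \<times> (- {0})"
  shows "0 < Q (pt c p)"
proof -
  obtain x u where x: "p = (chart_map c x, u)" "x \<in> chart_dom c" "u \<noteq> 0" using assms(3) by auto
  have "0 < Q (x, tvec c x u)"
    by (rule sq_norm_on_pos[OF assms(1) subspace_tangent_space])
      (simp_all add: tvec_in_tangent_space tvec_eq_0_iff assms(2) x)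
  then show ?thesis by (simp add: x pt_chart_map assms(2))
qed

text \<open>The return from squares to norms. Positivity off the zero section carries smoothness
  through the root, and the square in \<open>strongly_convex_norm\<close> cancels the root.\<close>

lemma finsler_metric_sqrt:
  assumes sm: "smooth_TM0 Q" and q: "\<And>x. sq_norm_on (tangent_space \<A> x) (\<lambda>v. Q (x, v))"
  shows "finsler_metric \<A> (\<lambda>p. sqrt (Q p))"
proof -
  have smc: "smooth_on (chart_image c \<times> (- {0})) (\<lambda>p. sqrt (Q (pt c p)))" if "c \<in> \<A>" for c
    using sm that sq_norm_pt_pos[OF q that] unfolding smooth_TM0_def
    by (intro smooth_on_real_sqrt open_chart_image_Times0) auto
  \<comment> \<open>A tangent vector is nonzero exactly if its coordinate in \<open>c\<close> is, so
    the domain prescribed by \<open>smooth_on_tangent\<close> is the one in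
    \<open>smooth_TM0\<close>.\<close>
  have im: "tangent_chart c ` ((tangent_bundle \<A> - zero_section \<A>) \<inter> tangent_chart_dom \<A> c)
      = chart_image c \<times> (- {0})" if "c \<in> \<A>" for c
  proof (intro equalityI subsetI)
    fix p :: "'e \<times> 'e" assume "p \<in> chart_image c \<times> - {0}"
    then obtain x u where x: "p = (chart_map c x, u)" "x \<in> chart_dom c" "u \<noteq> 0" by auto
    have "(x, tvec c x u) \<in> (tangent_bundle \<A> - zero_section \<A>) \<inter> tangent_chart_dom \<A> c"
      using x that by (auto simp: tangent_bundle_def zero_section_def tangent_chart_dom_def
          tvec_in_tangent_space tvec_eq_0_iff)
    moreover have "p = tangent_chart c (x, tvec c x u)"
      using x that by (simp add: tangent_chart_def tvec_self)
    ultimately show "p \<in> tangent_chart c ` ((tangent_bundle \<A> - zero_section \<A>) \<inter> tangent_chart_dom \<A> c)"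
      by (rule rev_image_eqI)
  next
    fix p assume "p \<in> tangent_chart c ` ((tangent_bundle \<A> - zero_section \<A>) \<inter> tangent_chart_dom \<A> c)"
    then obtain x v where x: "v \<in> tangent_space \<A> x" "v \<noteq> 0" "x \<in> chart_dom c"
      "p = (chart_map c x, v c)"
      by (auto simp: tangent_bundle_def zero_section_def tangent_chart_dom_def tangent_chart_def)
    then have "v c \<noteq> 0" using tvec_eq[OF x(1) that x(3)] tvec_eq_0_iff[OF that x(3)] by metis
    with x show "p \<in> chart_image c \<times> - {0}" by auto
  qed
  have "smooth_on_tangent \<A> (tangent_bundle \<A> - zero_section \<A>) (\<lambda>p. sqrt (Q p))"
    unfolding smooth_on_tangent_def
  proof
    fix c assume c: "c \<in> \<A>"
    show "smooth_on (tangent_chart c ` ((tangent_bundle \<A> - zero_section \<A>) \<inter> tangent_chart_dom \<A> c))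
        ((\<lambda>p. sqrt (Q p)) \<circ> inv_into (tangent_chart_dom \<A> c) (tangent_chart c))"
      unfolding im[OF c]
      by (rule smooth_on_cong[OF open_chart_image_Times0[OF c] _ smc[OF c]])
        (use inv_into_tangent_chart[OF c] in auto)
  qed
  moreover have "continuous_map (tangent_topology \<A>) euclideanreal (\<lambda>p. sqrt (Q p))"
    using sm by (intro continuous_map_tangent_topology continuous_on_real_sqrt)
      (auto simp: smooth_TM0_def)
  moreover have "norm_on (tangent_space \<A> x) (\<lambda>v. sqrt (Q (x, v)))" for x
    by (rule sq_norm_on_imp_norm_on[OF q subspace_tangent_space])
  moreover have "strongly_convex_norm (\<lambda>u. sqrt (Q (x, tangent_vector \<A> x c u)))"
    if c: "c \<in> \<A>" "x \<in> chart_dom c" for x c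
  proof -
    define f where "f u = Q (x, tvec c x u)" for u
    have f: "sq_norm_on UNIV f"
      unfolding f_def
      by (rule sq_norm_on_linear_comp[OF q linear_tvec[OF c]])
        (auto simp: tvec_in_tangent_space tvec_eq_0_iff c)
    have fp: "f u = Q (pt c (chart_map c x, u))" for u
      by (simp add: f_def pt_chart_map c)
    have "smooth_on (- {0 :: 'e}) (\<lambda>u. (chart_map c x, u))"
      by (intro smooth_on_Pair smooth_on_const smooth_on_bounded_linear bounded_linear_ident) auto
    then have sf: "smooth_on (- {0}) f"
      unfolding fp[abs_def]
      by (rule smooth_on_compose[OF _ open_chart_image_Times0[OF c(1)], rotated])
        (use sm c in \<open>auto simp: smooth_TM0_def\<close>)
    have "smooth_on (- {0}) (\<lambda>u. sqrt (f u))"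
      using sq_norm_on_pos[OF f] by (intro smooth_on_real_sqrt sf) auto
    moreover have "(\<lambda>u. (sqrt (f u))\<^sup>2) = f" using sq_norm_on_nonneg[OF f] by auto
    ultimately have "strongly_convex_norm (\<lambda>u. sqrt (f u))"
      unfolding strongly_convex_norm_def
      using sq_norm_on_imp_norm_on[OF f] pos_def_hessian_sq_norm[OF f sf] by simp
    then show ?thesis by (simp add: f_def tangent_vector_eq c)
  qed
  moreover have "0 \<le> sqrt (Q p)" if "p \<in> tangent_bundle \<A>" for p
    using that sq_norm_on_nonneg[OF q subspace_tangent_space] by (auto simp: tangent_bundle_def)
  ultimately show ?thesis unfolding finsler_metric_def by blast
qed

end

section \<open>Minorants of generalised norms\<close>

context
  fixes V :: "'v::real_vector set" and n :: "'v \<Rightarrow> ennreal"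
  assumes n: "generalised_norm V n" and V: "subspace V"
begin

lemma generalised_norm_domain:
  obtains D where "subspace D" "D \<subseteq> V" "norm_on D (\<lambda>v. enn2real (n v))"
    "\<And>v. v \<in> D \<Longrightarrow> n v < \<infinity>" "\<And>v. v \<in> V \<Longrightarrow> v \<notin> D \<Longrightarrow> n v = \<infinity>"
  using n unfolding generalised_norm_def by blast

lemma generalised_norm_0: "n 0 = 0"
proof -
  obtain D where D: "subspace D" "norm_on D (\<lambda>v. enn2real (n v))" "\<And>v. v \<in> D \<Longrightarrow> n v < \<infinity>"
    using generalised_norm_domain by metis
  have "0 \<in> D" by (rule subspace_0[OF D(1)])
  with D(2) have "enn2real (n 0) = 0" unfolding norm_on_def by blast
  with D(3)[OF \<open>0 \<in> D\<close>] show ?thesis by (auto simp: enn2real_eq_0_iff)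
qed

lemma generalised_norm_pos:
  assumes "v \<in> V" "v \<noteq> 0"
  shows "0 < n v"
proof -
  obtain D where D: "norm_on D (\<lambda>v. enn2real (n v))" "\<And>v. v \<in> V \<Longrightarrow> v \<notin> D \<Longrightarrow> n v = \<infinity>"
    using generalised_norm_domain by metis
  show ?thesis
  proof (cases "v \<in> D")
    case True
    with D(1) assms(2) have "enn2real (n v) \<noteq> 0" unfolding norm_on_def by blast
    then show ?thesis by (simp add: zero_less_iff_neq_zero enn2real_eq_0_iff)
  qed (use D(2) assms(1) in simp)
qed

text \<open>A nonzero multiple lies in the subspace \<open>D\<close> only if the vector itself does,
  so outside \<open>D\<close> both sides are infinite.\<close>

lemma generalised_norm_scale:
  assumes "v \<in> V" "a \<noteq> 0"
  shows "n (a *\<^sub>R v) = ennreal \<bar>a\<bar> * n v"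
proof -
  obtain D where D: "subspace D" "norm_on D (\<lambda>v. enn2real (n v))" "\<And>v. v \<in> D \<Longrightarrow> n v < \<infinity>"
    "\<And>v. v \<in> V \<Longrightarrow> v \<notin> D \<Longrightarrow> n v = \<infinity>"
    using generalised_norm_domain by metis
  show ?thesis
  proof (cases "v \<in> D")
    case True
    then have aD: "a *\<^sub>R v \<in> D" using D(1) by (simp add: subspace_scale)
    have "enn2real (n (a *\<^sub>R v)) = \<bar>a\<bar> * enn2real (n v)" using D(2) True unfolding norm_on_def by blast
    then have "ennreal (enn2real (n (a *\<^sub>R v))) = ennreal \<bar>a\<bar> * ennreal (enn2real (n v))"
      by (simp add: ennreal_mult)
    then show ?thesis using D(3)[OF True] D(3)[OF aD] by simp
  next
    case False
    have "a *\<^sub>R v \<notin> D"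
    proof
      assume "a *\<^sub>R v \<in> D"
      from subspace_scale[OF D(1) this, of "inverse a"] False assms(2) show False by simp
    qed
    then show ?thesis
      using D(4)[of v] D(4)[of "a *\<^sub>R v"] False assms V by (simp add: subspace_scale ennreal_mult_top)
  qed
qed

lemma generalised_norm_triangle:
  assumes "v \<in> V" "w \<in> V"
  shows "n (v + w) \<le> n v + n w"
proof -
  obtain D where D: "subspace D" "norm_on D (\<lambda>v. enn2real (n v))" "\<And>v. v \<in> D \<Longrightarrow> n v < \<infinity>"
    "\<And>v. v \<in> V \<Longrightarrow> v \<notin> D \<Longrightarrow> n v = \<infinity>"
    using generalised_norm_domain by metis
  show ?thesis
  proof (cases "v \<in> D \<and> w \<in> D")
    case True
    then have vw: "v + w \<in> D" using D(1) by (simp add: subspace_add)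
    have "enn2real (n (v + w)) \<le> enn2real (n v) + enn2real (n w)"
      using D(2) True unfolding norm_on_def by blast
    then have "ennreal (enn2real (n (v + w))) \<le> ennreal (enn2real (n v)) + ennreal (enn2real (n w))"
      by (simp flip: ennreal_plus)
    then show ?thesis using D(3)[of v] D(3)[of w] D(3)[OF vw] True by simp
  next
    case False
    then have "n v = \<infinity> \<or> n w = \<infinity>" using D(4) assms by blast
    then show ?thesis by auto
  qed
qed

end

text \<open>The sublevel set \<open>{n \<le> 1}\<close> is closed, convex and symmetric, so it is an intersection of strips.\<close>

lemma ex_linear_minorant:
  fixes n :: "'e::euclidean_space \<Rightarrow> ennreal"
  assumes zero: "n 0 = 0" and scale: "\<And>a u. a \<noteq> 0 \<Longrightarrow> n (a *\<^sub>R u) = ennreal \<bar>a\<bar> * n u"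
    and triangle: "\<And>u w. n (u + w) \<le> n u + n w" and pos: "\<And>u. u \<noteq> 0 \<Longrightarrow> 0 < n u"
    and cl: "closed {u. n u \<le> 1}" and t: "0 < t" "ennreal t < n v"
  shows "\<exists>l. t < l \<bullet> v \<and> (\<forall>u. ennreal \<bar>l \<bullet> u\<bar> \<le> n u)"
proof -
  define B where "B = {u. n u \<le> 1}"
  have "convex B"
    unfolding convex_alt
  proof (intro ballI allI impI)
    fix u w and s :: real assume uw: "u \<in> B" "w \<in> B" and s: "0 \<le> s \<and> s \<le> 1"
    show "(1 - s) *\<^sub>R u + s *\<^sub>R w \<in> B"
    proof (cases "s = 0 \<or> s = 1")
      case False
      have "n ((1 - s) *\<^sub>R u + s *\<^sub>R w) \<le> ennreal (1 - s) * n u + ennreal s * n w"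
        using triangle[of "(1 - s) *\<^sub>R u" "s *\<^sub>R w"] scale[of "1 - s" u] scale[of s w] s False by simp
      also have "\<dots> \<le> ennreal (1 - s) * 1 + ennreal s * 1"
        using uw by (intro add_mono mult_left_mono) (auto simp: B_def)
      also have "\<dots> = 1" using s by (simp flip: ennreal_plus)
      finally show ?thesis by (simp add: B_def)
    qed (use uw in auto)
  qed
  moreover have "inverse t *\<^sub>R v \<notin> B"
  proof
    assume "inverse t *\<^sub>R v \<in> B"
    then have "ennreal (inverse t) * n v \<le> 1" using scale[of "inverse t" v] t by (simp add: B_def)
    then have "ennreal t * (ennreal (inverse t) * n v) \<le> ennreal t * 1" by (rule mult_left_mono) simp
    moreover have "ennreal t * (ennreal (inverse t) * n v) = n v"
      using t(1) by (simp flip: mult.assoc ennreal_mult)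
    ultimately show False using t(2) by simp
  qed
  ultimately obtain a b where ab: "a \<bullet> (inverse t *\<^sub>R v) < b" "\<forall>x\<in>B. b < a \<bullet> x"
    using separating_hyperplane_closed_point[of B "inverse t *\<^sub>R v"] cl unfolding B_def by blast
  have "0 \<in> B" by (simp add: B_def zero)
  with ab(2) have b: "b < 0" by force
  \<comment> \<open>As 0 lies in \<open>B\<close>, the level \<open>b\<close> is negative, and
    division by it reverses both inequalities: \<open>l\<close> is below 1 on \<open>B\<close> and
    above 1 at v/t.\<close>
  define l where "l = inverse b *\<^sub>R a"
  have l_eq: "l \<bullet> u = (a \<bullet> u) / b" for u by (simp add: l_def divide_inverse)
  have "1 < l \<bullet> (inverse t *\<^sub>R v)" unfolding l_eq using ab(1) b by (simp only: less_divide_eq) simp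
  then have lv: "t < l \<bullet> v" using t(1) by (simp add: field_simps)
  have lB: "l \<bullet> u < 1" if "u \<in> B" for u unfolding l_eq using ab(2) that b by (simp add: divide_less_eq)
  have lB': "\<bar>l \<bullet> u\<bar> < 1" if "u \<in> B" for u
  proof -
    have "- u \<in> B" using that scale[of "-1" u] by (simp add: B_def)
    then show ?thesis using lB[OF that] lB[of "- u"] by (simp add: abs_less_iff)
  qed
  have "ennreal \<bar>l \<bullet> u\<bar> \<le> n u" for u
  proof (cases "u = 0 \<or> n u = \<infinity>")
    case False
    then have "0 < n u" "n u < \<infinity>" using pos by (auto simp: less_top)
    then obtain r where r: "n u = ennreal r" "0 < r" by (cases "n u") auto
    have "inverse r *\<^sub>R u \<in> B"
      using scale[of "inverse r" u] r by (simp add: B_def flip: ennreal_mult)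
    from lB'[OF this] have "\<bar>l \<bullet> u\<bar> < r" using r(2) by (simp add: abs_mult field_simps)
    then show ?thesis using r by (simp add: ennreal_leI)
  qed (auto simp: zero)
  with lv show ?thesis by blast
qed

lemma ex_real_between_ennreal:
  fixes s :: ennreal
  assumes "ennreal r < s" "0 \<le> r"
  obtains r' where "r < r'" "ennreal r' < s"
proof -
  obtain z where z: "ennreal r < z" "z < s" using dense[OF assms(1)] by blast
  then obtain r' where "z = ennreal r'" "0 \<le> r'" by (cases z) auto
  with z assms(2) that show ?thesis by (simp add: ennreal_less_iff)
qed

section \<open>Quadratic minorants near a point of the manifold\<close>

definition quad :: "'e::euclidean_space \<Rightarrow> real \<Rightarrow> 'e \<Rightarrow> real" where
  "quad a \<epsilon> u = (a \<bullet> u)\<^sup>2 + \<epsilon> * (u \<bullet> u)"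

lemma quad_nonneg: "0 \<le> \<epsilon> \<Longrightarrow> 0 \<le> quad a \<epsilon> u"
  by (simp add: quad_def)

lemma quad_scale: "quad a \<epsilon> (s *\<^sub>R u) = s\<^sup>2 * quad a \<epsilon> u"
  by (simp add: quad_def power_mult_distrib power2_eq_square algebra_simps)

text \<open>A positive definite quadratic form is its own modulus: the convexity inequality is then
  an identity, a weighted parallelogram law.\<close>

lemma sq_norm_on_quad: "0 < \<epsilon> \<Longrightarrow> sq_norm_on UNIV (quad a \<epsilon>)"
proof -
  assume e: "0 < \<epsilon>"
  have "sq_norm_with UNIV (quad a \<epsilon>) (quad a \<epsilon>)"
  proof (rule sq_norm_withI)
    fix v w and t :: real
    show "quad a \<epsilon> ((1 - t) *\<^sub>R v + t *\<^sub>R w) \<le> (1 - t) * quad a \<epsilon> v + t * quad a \<epsilon> w - t * (1 - t) * quad a \<epsilon> (v - w)"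
      by (simp add: quad_def inner_add inner_diff inner_commute[of w v] power2_eq_square algebra_simps)
    show "0 < quad a \<epsilon> v" if "v \<noteq> 0"
      using that e unfolding quad_def by (intro add_nonneg_pos mult_pos_pos) auto
  qed (rule quad_scale)+
  then show ?thesis using sq_norm_on_def by blast
qed

locale metric_atlas = atlas \<A>
  for \<A> :: "('a::{t2_space,second_countable_topology}, 'e::euclidean_space) chart set" +
  fixes \<rho> :: "'a \<times> ('a, 'e) tvec \<Rightarrow> ennreal"
  assumes \<rho>: "generalised_metric \<A> \<rho>"
begin

lemma generalised_norm_metric: "generalised_norm (tangent_space \<A> x) (\<lambda>v. \<rho> (x, v))"
  using \<rho> by (simp add: generalised_metric_def)

lemma open_metric_greater:
  assumes c: "c \<in> \<A>"
  shows "open {p \<in> chart_image c \<times> UNIV. t < \<rho> (pt c p)}"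
proof -
  have "openin (tangent_topology \<A>) {p \<in> topspace (tangent_topology \<A>). t < \<rho> p}"
    using \<rho> by (simp add: generalised_metric_def lower_semicontinuous_map_def)
  note open_pt_vimage[OF this c]
  moreover have "pt c p \<in> tangent_bundle \<A>" if "p \<in> chart_image c \<times> UNIV" for p
    using pt_in[OF c that] by (auto simp: tangent_chart_dom_def tangent_bundle_def)
  then have "{p \<in> chart_image c \<times> UNIV. pt c p \<in> {p \<in> topspace (tangent_topology \<A>). t < \<rho> p}}
      = {p \<in> chart_image c \<times> UNIV. t < \<rho> (pt c p)}"
    unfolding topspace_tangent_topology by blast
  ultimately show ?thesis by simp
qed

lemma metric_pt_scale:
  assumes "c \<in> \<A>" "y \<in> chart_image c" "a \<noteq> 0"
  shows "\<rho> (pt c (y, a *\<^sub>R u)) = ennreal \<bar>a\<bar> * \<rho> (pt c (y, u))"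
  using generalised_norm_scale[OF generalised_norm_metric subspace_tangent_space
      tvec_in_tangent_space[OF assms(1) chart_inv_in[OF assms(2)]] assms(3)]
    linear_tvec[OF assms(1) chart_inv_in[OF assms(2)]]
  by (simp add: pt_def linear_scale)

text \<open>The linear minorant at \<open>y0\<close> is shrunk until it is strict on the unit sphere
  of coordinates. Strictness is open and leaves room for the term with \<open>\<epsilon>\<close>,
  compactness makes it uniform in the direction, and homogeneity extends it to all vectors.\<close>

lemma ex_local_minorant:
  assumes c: "c \<in> \<A>" and y0: "y0 \<in> chart_image c" and t: "0 < t" "ennreal t < \<rho> (pt c (y0, u0))"
  obtains W a \<epsilon> where "open W" "y0 \<in> W" "W \<subseteq> chart_image c" "0 < \<epsilon>" "t\<^sup>2 < quad a \<epsilon> u0"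
    "\<And>y u. y \<in> W \<Longrightarrow> ennreal (sqrt (quad a \<epsilon> u)) \<le> \<rho> (pt c (y, u))"
proof -
  define x where "x = chart_inv c y0"
  have x: "x \<in> chart_dom c" using chart_inv_in[OF y0] by (simp add: x_def)
  define n where "n u = \<rho> (pt c (y0, u))" for u
  have n_tvec: "n u = \<rho> (x, tvec c x u)" for u by (simp add: n_def pt_def x_def)
  note gn = generalised_norm_metric[of x] subspace_tangent_space[of x]
  have zero: "n 0 = 0"
    using generalised_norm_0[OF gn] linear_0[OF linear_tvec[OF c x]] by (simp add: n_tvec)
  have scale: "n (a *\<^sub>R u) = ennreal \<bar>a\<bar> * n u" if "a \<noteq> 0" for a u
    using metric_pt_scale[OF c y0 that] by (simp add: n_def)
  have triangle: "n (u + w) \<le> n u + n w" for u w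
    using generalised_norm_triangle[OF gn tvec_in_tangent_space[OF c x, of u] tvec_in_tangent_space[OF c x, of w]]
    by (simp add: n_tvec linear_add[OF linear_tvec[OF c x]])
  have pos: "0 < n u" if "u \<noteq> 0" for u
    using generalised_norm_pos[OF gn tvec_in_tangent_space[OF c x, of u]] that tvec_eq_0_iff[OF c x]
    by (simp add: n_tvec)
  have "closed {u. n u \<le> 1}"
  proof -
    have "open ((\<lambda>u. (y0, u)) -` {p \<in> chart_image c \<times> UNIV. 1 < \<rho> (pt c p)})"
      by (intro open_vimage open_metric_greater[OF c] continuous_intros)
    moreover have "(\<lambda>u. (y0, u)) -` {p \<in> chart_image c \<times> UNIV. 1 < \<rho> (pt c p)} = - {u. n u \<le> 1}"
      using y0 by (auto simp: n_def not_le)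
    ultimately show ?thesis by (simp add: closed_def)
  qed
  from ex_linear_minorant[OF zero scale triangle pos this t(1)] t(2)
  obtain l where l: "t < l \<bullet> u0" "\<And>u. ennreal \<bar>l \<bullet> u\<bar> \<le> n u" unfolding n_def by blast
  \<comment> \<open>The mean of 1 and t / (l \<bullet> u0): below 1, hence strict, but large enough
    to keep the value at \<open>u0\<close> above \<open>t\<close>.\<close>
  define s where "s = (1 + t / (l \<bullet> u0)) / 2"
  have s: "0 < s" "s < 1" "t < s * (l \<bullet> u0)" using l(1) t(1) by (simp_all add: s_def field_simps)
  define a where "a = s *\<^sub>R l"
  have au0: "t < a \<bullet> u0" using s by (simp add: a_def)
  \<comment> \<open>Shrinking gains nothing where \<open>l\<close> vanishes; there positivity of the
    generalised norm gives the strict inequality.\<close>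
  have strict: "ennreal \<bar>a \<bullet> u\<bar> < n u" if "u \<noteq> 0" for u
  proof (cases "l \<bullet> u = 0")
    case True
    then show ?thesis using pos[OF that] by (simp add: a_def)
  next
    case False
    then have "\<bar>a \<bullet> u\<bar> < \<bar>l \<bullet> u\<bar>" using s by (simp add: a_def abs_mult)
    then have "ennreal \<bar>a \<bullet> u\<bar> < ennreal \<bar>l \<bullet> u\<bar>" by (simp add: ennreal_less_iff)
    then show ?thesis using l(2) less_le_trans by blast
  qed
  define e where "e k = inverse (real (Suc k))" for k
  have e: "0 < e k" for k by (simp add: e_def)
  define O' where "O' k = {p \<in> chart_image c \<times> UNIV. ennreal (sqrt (quad a (e k) (snd p))) < \<rho> (pt c p)}" for k
  have O_open: "open (O' k)" for k
  proof -
    \<comment> \<open>A real number \<open>r\<close> strictly between the two sides splits the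
      inequality into an open condition on \<open>\<rho>\<close>, by lower semicontinuity, and an
      open condition on the continuous \<open>quad\<close>.\<close>
    have "O' k = (\<Union>r. {p \<in> chart_image c \<times> UNIV. ennreal r < \<rho> (pt c p)} \<inter> {p. sqrt (quad a (e k) (snd p)) < r})"
    proof (intro equalityI subsetI)
      fix p assume p: "p \<in> O' k"
      then obtain r where "sqrt (quad a (e k) (snd p)) < r" "ennreal r < \<rho> (pt c p)"
        using ex_real_between_ennreal[of "sqrt (quad a (e k) (snd p))" "\<rho> (pt c p)"]
          quad_nonneg[of "e k"] e[of k] by (auto simp: O'_def)
      with p show "p \<in> (\<Union>r. {p \<in> chart_image c \<times> UNIV. ennreal r < \<rho> (pt c p)} \<inter> {p. sqrt (quad a (e k) (snd p)) < r})"
        by (auto simp: O'_def)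
    next
      fix p assume "p \<in> (\<Union>r. {p \<in> chart_image c \<times> UNIV. ennreal r < \<rho> (pt c p)} \<inter> {p. sqrt (quad a (e k) (snd p)) < r})"
      then obtain r where p: "p \<in> chart_image c \<times> UNIV" "ennreal r < \<rho> (pt c p)" "sqrt (quad a (e k) (snd p)) < r"
        by blast
      then have "ennreal (sqrt (quad a (e k) (snd p))) \<le> ennreal r" by (intro ennreal_leI) simp
      with p show "p \<in> O' k" by (simp add: O'_def)
    qed
    moreover have "open {p :: 'e \<times> 'e. sqrt (quad a (e k) (snd p)) < r}" for r
      unfolding quad_def by (intro open_Collect_less continuous_intros)
    then have "open (\<Union>r. {p \<in> chart_image c \<times> UNIV. ennreal r < \<rho> (pt c p)} \<inter> {p. sqrt (quad a (e k) (snd p)) < r})"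
      by (intro open_UN ballI open_Int open_metric_greater[OF c])
    ultimately show ?thesis by simp
  qed
  have O_mono: "O' j \<subseteq> O' k" if "j \<le> k" for j k
  proof
    fix p assume p: "p \<in> O' j"
    have "e k \<le> e j" using that by (simp add: e_def)
    then have "quad a (e k) (snd p) \<le> quad a (e j) (snd p)"
      by (simp add: quad_def mult_right_mono)
    then have "ennreal (sqrt (quad a (e k) (snd p))) \<le> ennreal (sqrt (quad a (e j) (snd p)))"
      by (intro ennreal_leI) simp
    with p show "p \<in> O' k" by (auto simp: O'_def)
  qed
  let ?K = "{y0} \<times> sphere (0 :: 'e) 1"
  have K: "compact ?K" by (intro compact_Times) auto
  have cover: "?K \<subseteq> (\<Union>k\<in>UNIV. O' k)"
  proof
    fix p assume "p \<in> ?K"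
    then obtain u where p: "p = (y0, u)" "norm u = 1" by auto
    then have "u \<noteq> 0" by auto
    from strict[OF this] obtain r where r: "\<bar>a \<bullet> u\<bar> < r" "ennreal r < n u"
      using ex_real_between_ennreal by (metis abs_ge_zero)
    then have "(a \<bullet> u)\<^sup>2 < r\<^sup>2" by (metis abs_ge_zero power2_abs power_strict_mono zero_less_numeral)
    then obtain k where "e k < r\<^sup>2 - (a \<bullet> u)\<^sup>2"
      using reals_Archimedean[of "r\<^sup>2 - (a \<bullet> u)\<^sup>2"] by (auto simp: e_def)
    then have "quad a (e k) u < r\<^sup>2" using p(2) by (simp add: quad_def dot_square_norm)
    then have "sqrt (quad a (e k) u) \<le> r" using r(1) by (intro real_le_lsqrt) auto
    then have "ennreal (sqrt (quad a (e k) u)) \<le> ennreal r" by (rule ennreal_leI)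
    then have "ennreal (sqrt (quad a (e k) u)) < n u" using r(2) by (rule le_less_trans)
    then show "p \<in> (\<Union>k\<in>UNIV. O' k)" using p(1) y0 by (auto simp: O'_def n_def)
  qed
  obtain C where C: "C \<subseteq> UNIV" "finite C" "?K \<subseteq> (\<Union>k\<in>C. O' k)"
    by (rule compactE_image[OF K O_open cover])
  \<comment> \<open>The sets \<open>O' k\<close> increase, so the largest index of the finite
    subcover does alone; 0 is inserted to have a maximum in any case.\<close>
  define k where "k = Max (insert 0 C)"
  have "O' j \<subseteq> O' k" if "j \<in> C" for j using that C(2) by (intro O_mono) (simp add: k_def)
  with C(3) have "?K \<subseteq> O' k" by blast
  \<comment> \<open>The tube lemma turns the open neighbourhood of the sphere over \<open>y0\<close>
    into a neighbourhood \<open>W\<close> of \<open>y0\<close> that serves all directions at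
    once.\<close>
  from Elementary_Topology.tube_lemma[OF compact_sphere O_open this] obtain W where W: "y0 \<in> W" "open W" "W \<times> sphere 0 1 \<subseteq> O' k" by auto
  have le: "ennreal (sqrt (quad a (e k) u)) \<le> \<rho> (pt c (y, u))" if y: "y \<in> W \<inter> chart_image c" for y u
  proof (cases "u = 0")
    case True
    then show ?thesis by (simp add: quad_def)
  next
    case False
    define w where "w = inverse (norm u) *\<^sub>R u"
    have w: "w \<in> sphere 0 1" "u = norm u *\<^sub>R w" using False by (simp_all add: w_def)
    then have "(y, w) \<in> O' k" using W(3) y by blast
    then have "ennreal (sqrt (quad a (e k) w)) \<le> \<rho> (pt c (y, w))" by (simp add: O'_def less_imp_le)
    then have "ennreal (norm u) * ennreal (sqrt (quad a (e k) w)) \<le> ennreal (norm u) * \<rho> (pt c (y, w))"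
      by (rule mult_left_mono) simp
    also have "\<dots> = \<rho> (pt c (y, u))"
      using metric_pt_scale[OF c, of y "norm u" w] w(2) False y by simp
    also have "ennreal (norm u) * ennreal (sqrt (quad a (e k) w)) = ennreal (sqrt (quad a (e k) u))"
    proof -
      have "quad a (e k) u = (norm u)\<^sup>2 * quad a (e k) w" by (subst w(2)) (rule quad_scale)
      then show ?thesis by (simp add: real_sqrt_mult ennreal_mult quad_nonneg e less_imp_le)
    qed
    finally show ?thesis .
  qed
  have "t\<^sup>2 < (a \<bullet> u0)\<^sup>2" using au0 t(1) by (intro power_strict_mono) auto
  also have "\<dots> \<le> quad a (e k) u0" using e[of k] by (simp add: quad_def)
  finally have "t\<^sup>2 < quad a (e k) u0" .
  then show ?thesis
    using W y0 le e[of k] open_chart_image[OF c]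
    by (intro that[of "W \<inter> chart_image c" "e k" a]) auto
qed

end

section \<open>Gluing and extension by zero of smooth functions on the tangent bundle\<close>

context atlas
begin

lemma smooth_TM_const: "smooth_TM (\<lambda>p. a)"
  by (simp add: smooth_TM_def smooth_on_const)

lemma smooth_TM_add: "smooth_TM f \<Longrightarrow> smooth_TM g \<Longrightarrow> smooth_TM (\<lambda>p. f p + g p)"
  unfolding smooth_TM_def by (intro ballI smooth_on_add open_chart_image_Times) auto

lemma smooth_TM_mult: "smooth_TM f \<Longrightarrow> smooth_TM g \<Longrightarrow> smooth_TM (\<lambda>p. f p * g p)"
  unfolding smooth_TM_def by (intro ballI smooth_on_mult open_chart_image_Times) auto

lemma smooth_TM_diff: "smooth_TM f \<Longrightarrow> smooth_TM g \<Longrightarrow> smooth_TM (\<lambda>p. f p - g p)"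
  unfolding smooth_TM_def by (intro ballI smooth_on_diff open_chart_image_Times) auto

lemma smooth_TM_sum: "(\<And>i. i \<in> I \<Longrightarrow> smooth_TM (f i)) \<Longrightarrow> smooth_TM (\<lambda>p. \<Sum>i\<in>I. f i p)"
  unfolding smooth_TM_def by (intro ballI smooth_on_sum open_chart_image_Times) auto

lemma smooth_TM_prod: "(\<And>i. i \<in> I \<Longrightarrow> smooth_TM (f i)) \<Longrightarrow> smooth_TM (\<lambda>p. \<Prod>i\<in>I. f i p)"
  unfolding smooth_TM_def by (intro ballI smooth_on_prod open_chart_image_Times) auto

lemma open_chart_inv_vimage:
  assumes "c \<in> \<A>" "open U"
  shows "open ((chart_inv c -` U \<inter> chart_image c) \<times> (UNIV :: 'e set))"
proof -
  have "open (chart_inv c -` U \<inter> chart_image c)"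
    using assms continuous_on_chart_inv[OF assms(1)]
    by (intro continuous_on_open_vimage[THEN iffD1, rule_format] open_chart_image)
  then show ?thesis by (simp add: open_Times)
qed

lemma fst_pt: "fst (pt c p) = chart_inv c (fst p)"
  by (simp add: pt_def case_prod_beta)

lemma smooth_TM_localI:
  assumes "\<And>x. \<exists>U f. open U \<and> x \<in> U \<and> smooth_TM f \<and> (\<forall>p. fst p \<in> U \<longrightarrow> H p = f p)"
  shows "smooth_TM H"
  unfolding smooth_TM_def
proof (intro ballI smooth_on_local)
  fix c p assume c: "c \<in> \<A>" and p: "p \<in> chart_image c \<times> (UNIV :: 'e set)"
  obtain U f where U: "open U" "chart_inv c (fst p) \<in> U" "smooth_TM f" "\<And>p. fst p \<in> U \<Longrightarrow> H p = f p"
    using assms by meson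
  let ?N = "(chart_inv c -` U \<inter> chart_image c) \<times> (UNIV :: 'e set)"
  have N: "open ?N" by (rule open_chart_inv_vimage[OF c U(1)])
  have "smooth_on (chart_image c \<times> UNIV) (\<lambda>p. f (pt c p))"
    using U(3) c by (simp add: smooth_TM_def)
  then have "smooth_on ?N (\<lambda>p. f (pt c p))" by (rule smooth_on_subset) auto
  then have "smooth_on ?N (\<lambda>p. H (pt c p))"
  proof (rule smooth_on_cong[OF N, rotated])
    show "f (pt c p) = H (pt c p)" if "p \<in> ?N" for p
      using that U(4)[of "pt c p"] by (auto simp: fst_pt)
  qed
  moreover have "p \<in> ?N" using p U(2) by auto
  ultimately show "\<exists>T. open T \<and> p \<in> T \<and> smooth_on T (\<lambda>p. H (pt c p))" using N by blast
qed

text \<open>The image of the compact set \<open>K\<close> is closed in the whole manifold because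
  that is Hausdorff. So the extension vanishes over a neighbourhood of every point outside the
  domain of \<open>c\<close>, boundary points included.\<close>

lemma smooth_TM_extend_zero:
  fixes f :: "'e \<times> 'e \<Rightarrow> real"
  assumes c: "c \<in> \<A>" and f: "smooth_on UNIV f" and K: "compact K" "K \<subseteq> chart_image c"
    and supp: "\<And>p. fst p \<notin> K \<Longrightarrow> f p = 0"
  shows "smooth_TM (\<lambda>p. if fst p \<in> chart_dom c then f (tangent_chart c p) else 0)"
    (is "smooth_TM ?H")
  unfolding smooth_TM_def
proof (intro ballI smooth_on_local)
  fix d p assume d: "d \<in> \<A>" and p: "p \<in> chart_image d \<times> (UNIV :: 'e set)"
  show "\<exists>T. open T \<and> p \<in> T \<and> smooth_on T (\<lambda>p. ?H (pt d p))"
  proof (cases "chart_inv d (fst p) \<in> chart_dom c")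
    case True
    let ?T = "overlap d c \<times> (UNIV :: 'e set)"
    have T: "open ?T" using open_overlap[OF d c] by (simp add: open_Times)
    have "smooth_on ?T (\<lambda>p. f (tangent_transition d c p))"
      by (rule smooth_on_compose[OF T open_UNIV smooth_on_tangent_transition[OF d c] f]) simp
    then have "smooth_on ?T (\<lambda>p. ?H (pt d p))"
    proof (rule smooth_on_cong[OF T, rotated])
      fix p :: "'e \<times> 'e" assume p: "p \<in> ?T"
      then have "fst (pt d p) \<in> chart_dom c" by (auto simp: fst_pt chart_inv_chart_map[OF d])
      then show "f (tangent_transition d c p) = ?H (pt d p)"
        using tangent_chart_pt_overlap[OF d c p] by simp
    qed
    moreover have "p \<in> ?T"
    proof -
      obtain x where x: "fst p = chart_map d x" "x \<in> chart_dom d" using p by auto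
      with True have "x \<in> chart_dom c" by (simp add: chart_inv_chart_map[OF d])
      with x p show ?thesis by (auto simp: mem_Times_iff)
    qed
    ultimately show ?thesis using T by blast
  next
    case False
    let ?C = "chart_inv c ` K"
    have "compact ?C"
      using K continuous_on_chart_inv[OF c] by (intro compact_continuous_image) (rule continuous_on_subset)
    then have o: "open (- ?C)" by (simp add: compact_imp_closed open_Compl)
    let ?N = "(chart_inv d -` (- ?C) \<inter> chart_image d) \<times> (UNIV :: 'e set)"
    have N: "open ?N" by (rule open_chart_inv_vimage[OF d o])
    have "smooth_on ?N (\<lambda>p. 0 :: real)" by (rule smooth_on_const)
    then have "smooth_on ?N (\<lambda>p. ?H (pt d p))"
    proof (rule smooth_on_cong[OF N, rotated])
      fix p :: "'e \<times> 'e" assume p: "p \<in> ?N"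
      show "0 = ?H (pt d p)"
      proof (cases "fst (pt d p) \<in> chart_dom c")
        case True
        have "fst (pt d p) \<notin> ?C" using p by (auto simp: fst_pt)
        then have "chart_map c (fst (pt d p)) \<notin> K"
          using chart_inv_chart_map[OF c True] by (metis imageI)
        then show ?thesis using supp by (simp add: tangent_chart_def case_prod_beta)
      qed simp
    qed
    moreover have "p \<in> ?N"
    proof -
      have "?C \<subseteq> chart_dom c" by (intro image_subsetI chart_inv_in) (rule subsetD[OF K(2)])
      then have "chart_inv d (fst p) \<notin> ?C" using False by (rule contra_subsetD)
      then show ?thesis using p by auto
    qed
    ultimately show ?thesis using N by blast
  qed
qed

end

section \<open>Countably many local minorants with cutoff functions\<close>

context metric_atlas
begin

text \<open>The bound by the square of \<open>\<rho>\<close> in real arithmetic: an infinite value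
  of \<open>\<rho>\<close> imposes no condition.\<close>

definition below :: "('a \<times> ('a, 'e) tvec \<Rightarrow> real) \<Rightarrow> 'a \<times> ('a, 'e) tvec \<Rightarrow> bool" where
  "below q p \<longleftrightarrow> (\<rho> p < \<infinity> \<longrightarrow> q p \<le> (enn2real (\<rho> p))\<^sup>2)"

lemma below_if_sqrt_le:
  assumes "ennreal (sqrt (q p)) \<le> \<rho> p" "0 \<le> q p"
  shows "below q p"
  unfolding below_def
proof
  assume "\<rho> p < \<infinity>"
  then obtain r where r: "\<rho> p = ennreal r" "0 \<le> r" by (cases "\<rho> p") auto
  with assms have "sqrt (q p) \<le> r" by simp
  then have "q p \<le> r\<^sup>2" by (rule sqrt_le_D)
  with r show "q p \<le> (enn2real (\<rho> p))\<^sup>2" by simp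
qed

lemma sqrt_le_if_below:
  assumes "below q p"
  shows "ennreal (sqrt (q p)) \<le> \<rho> p"
proof (cases "\<rho> p")
  case (real r)
  with assms have "q p \<le> r\<^sup>2" by (simp add: below_def)
  then have "sqrt (q p) \<le> r" using real(1) by (rule real_le_lsqrt[rotated])
  with real show ?thesis by (simp add: ennreal_leI)
qed simp

text \<open>
  A local minorant \<open>q\<close> of \<open>\<rho>\<^sup>2\<close> together with a cutoff function \<open>\<phi>\<close>; nothing is required of
  \<open>q\<close> where \<open>\<phi> = 0\<close>.
\<close>

definition piece :: "('a \<Rightarrow> real) \<Rightarrow> ('a \<times> ('a, 'e) tvec \<Rightarrow> real) \<Rightarrow> bool" where
  "piece \<phi> q \<longleftrightarrow> smooth_TM (\<lambda>p. \<phi> (fst p)) \<and> smooth_TM (\<lambda>p. \<phi> (fst p) * q p) \<and>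
     (\<forall>x. 0 \<le> \<phi> x \<and> \<phi> x \<le> 1) \<and>
     (\<forall>x. \<phi> x \<noteq> 0 \<longrightarrow> sq_norm_on (tangent_space \<A> x) (\<lambda>v. q (x, v)) \<and>
        (\<forall>v\<in>tangent_space \<A> x. below q (x, v)))"

lemma piece_smooth: "piece \<phi> q \<Longrightarrow> smooth_TM (\<lambda>p. \<phi> (fst p))"
  and piece_smooth_mult: "piece \<phi> q \<Longrightarrow> smooth_TM (\<lambda>p. \<phi> (fst p) * q p)"
  and piece_nonneg: "piece \<phi> q \<Longrightarrow> 0 \<le> \<phi> x"
  and piece_le_1: "piece \<phi> q \<Longrightarrow> \<phi> x \<le> 1"
  and piece_sq_norm: "piece \<phi> q \<Longrightarrow> \<phi> x \<noteq> 0 \<Longrightarrow> sq_norm_on (tangent_space \<A> x) (\<lambda>v. q (x, v))"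
  and piece_below: "piece \<phi> q \<Longrightarrow> \<phi> x \<noteq> 0 \<Longrightarrow> v \<in> tangent_space \<A> x \<Longrightarrow> below q (x, v)"
  unfolding piece_def by blast+

definition cutoff :: "('a, 'e) chart \<Rightarrow> 'e \<Rightarrow> real \<Rightarrow> 'a \<Rightarrow> real" where
  "cutoff c b r x = (if x \<in> chart_dom c then plateau b r (chart_map c x) else 0)"

text \<open>The ball of radius \<open>2 * r\<close> is where \<open>plateau b r\<close> can be
  nonzero, so the form is a minorant wherever its cutoff does not vanish.\<close>

definition minorant_params :: "('a, 'e) chart \<Rightarrow> ('e \<times> real \<times> 'e \<times> real) set" where
  "minorant_params c = {(b, r, a, \<epsilon>). 0 < r \<and> 0 < \<epsilon> \<and> cball b (2 * r) \<subseteq> chart_image c \<and>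
     (\<forall>y\<in>cball b (2 * r). \<forall>u. ennreal (sqrt (quad a \<epsilon> u)) \<le> \<rho> (pt c (y, u)))}"

lemma piece_cutoff:
  assumes c: "c \<in> \<A>" and j: "(b, r, a, \<epsilon>) \<in> minorant_params c"
  shows "piece (cutoff c b r) (\<lambda>p. quad a \<epsilon> (snd p c))"
proof -
  have r: "0 < r" and e: "0 < \<epsilon>" and K: "cball b (2 * r) \<subseteq> chart_image c"
    and le: "\<And>y u. y \<in> cball b (2 * r) \<Longrightarrow> ennreal (sqrt (quad a \<epsilon> u)) \<le> \<rho> (pt c (y, u))"
    using j by (auto simp: minorant_params_def)
  have supp: "y \<in> cball b (2 * r)" if "plateau b r y \<noteq> 0" for y
    using plateau_eq_0[OF r, of y b] that by (force simp: dist_commute)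
  have s1: "smooth_on UNIV (\<lambda>p :: 'e \<times> 'e. plateau b r (fst p))"
    by (rule smooth_on_compose[OF open_UNIV open_UNIV smooth_on_bounded_linear[OF bounded_linear_fst]
          smooth_on_plateau]) simp
  have s2: "smooth_on UNIV (\<lambda>p :: 'e \<times> 'e. plateau b r (fst p) * quad a \<epsilon> (snd p))"
    unfolding quad_def power2_eq_square
    by (intro smooth_on_mult smooth_on_add smooth_on_inner smooth_on_const s1 open_UNIV
        smooth_on_bounded_linear bounded_linear_snd)
  have "smooth_TM (\<lambda>p. if fst p \<in> chart_dom c then plateau b r (fst (tangent_chart c p)) else 0)"
    by (rule smooth_TM_extend_zero[OF c s1 compact_cball K]) (use supp in blast)
  moreover have "smooth_TM (\<lambda>p. if fst p \<in> chart_dom c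
      then plateau b r (fst (tangent_chart c p)) * quad a \<epsilon> (snd (tangent_chart c p)) else 0)"
    by (rule smooth_TM_extend_zero[OF c s2 compact_cball K]) (use supp in force)
  moreover have "sq_norm_on (tangent_space \<A> x) (\<lambda>v. quad a \<epsilon> (v c))
      \<and> (\<forall>v\<in>tangent_space \<A> x. below (\<lambda>p. quad a \<epsilon> (snd p c)) (x, v))"
    if "cutoff c b r x \<noteq> 0" for x
  proof
    have x: "x \<in> chart_dom c" "chart_map c x \<in> cball b (2 * r)"
      using that supp by (auto simp: cutoff_def split: if_splits)
    have "linear (\<lambda>v :: ('a, 'e) tvec. v c)"
      by (rule linearI) (simp_all add: scaleR_fun_def)
    then show "sq_norm_on (tangent_space \<A> x) (\<lambda>v. quad a \<epsilon> (v c))"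
    proof (rule sq_norm_on_linear_comp[OF sq_norm_on_quad[OF e] _ _ subspace_tangent_space])
      fix v assume v: "v \<in> tangent_space \<A> x" "v c = 0"
      then show "v = 0" using tvec_eq[OF v(1) c x(1)] tvec_eq_0_iff[OF c x(1), of "v c"] by simp
    qed simp
    show "\<forall>v\<in>tangent_space \<A> x. below (\<lambda>p. quad a \<epsilon> (snd p c)) (x, v)"
    proof
      fix v assume v: "v \<in> tangent_space \<A> x"
      have "ennreal (sqrt (quad a \<epsilon> (v c))) \<le> \<rho> (x, v)"
        using le[OF x(2), of "v c"] by (simp add: pt_chart_map[OF c x(1)] tvec_eq[OF v c x(1)])
      then show "below (\<lambda>p. quad a \<epsilon> (snd p c)) (x, v)"
        using e by (intro below_if_sqrt_le) (simp_all add: quad_nonneg)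
    qed
  qed
  moreover have "(\<lambda>p. cutoff c b r (fst p)) =
      (\<lambda>p. if fst p \<in> chart_dom c then plateau b r (fst (tangent_chart c p)) else 0)"
    by (simp add: fun_eq_iff cutoff_def tangent_chart_def case_prod_beta)
  moreover have "(\<lambda>p. cutoff c b r (fst p) * quad a \<epsilon> (snd p c)) =
      (\<lambda>p. if fst p \<in> chart_dom c
        then plateau b r (fst (tangent_chart c p)) * quad a \<epsilon> (snd (tangent_chart c p)) else 0)"
    by (simp add: fun_eq_iff cutoff_def tangent_chart_def case_prod_beta)
  ultimately show ?thesis
    unfolding piece_def by (simp add: cutoff_def plateau_nonneg plateau_le_1)
qed

text \<open>With the height \<open>t\<close> as an additional coordinate, approximation of
  \<open>\<rho>\<close> from below becomes a covering: the regions cover all points with 0 < t <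
  \<rho>. A countable subfamily with the same union then still has supremum \<open>\<rho>\<close>.
  The ball has radius \<open>r\<close>, where the cutoff equals 1.\<close>

definition region :: "'e \<times> real \<times> 'e \<times> real \<Rightarrow> ('e \<times> 'e \<times> real) set" where
  "region = (\<lambda>(b, r, a, \<epsilon>). {(y, u, t). dist y b < r \<and> t\<^sup>2 < quad a \<epsilon> u})"

lemma open_region: "open (region j)"
proof -
  obtain b r a \<epsilon> where j: "j = (b, r, a, \<epsilon>)" by (cases j) auto
  have eq: "region j = {p. dist (fst p) b < r} \<inter> {p. (snd (snd p))\<^sup>2 < quad a \<epsilon> (fst (snd p))}"
    by (auto simp: region_def j)
  show ?thesis
    unfolding eq quad_def by (intro open_Int open_Collect_less continuous_intros)
qed

lemma ex_region:
  assumes c: "c \<in> \<A>" and y: "y \<in> chart_image c" and t: "0 < t" "ennreal t < \<rho> (pt c (y, u))"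
  shows "\<exists>j\<in>minorant_params c. (y, u, t) \<in> region j"
proof -
  obtain W a \<epsilon> where W: "open W" "y \<in> W" "W \<subseteq> chart_image c" "0 < \<epsilon>" "t\<^sup>2 < quad a \<epsilon> u"
    "\<And>y u. y \<in> W \<Longrightarrow> ennreal (sqrt (quad a \<epsilon> u)) \<le> \<rho> (pt c (y, u))"
    using ex_local_minorant[OF c y t] by metis
  obtain s where s: "0 < s" "cball y s \<subseteq> W" using W(1,2) open_contains_cball by blast
  \<comment> \<open>Half of \<open>s\<close>, because the form must be a minorant on the ball of
    twice the radius.\<close>
  have "(y, s / 2, a, \<epsilon>) \<in> minorant_params c"
    using s W by (auto simp: minorant_params_def)
  moreover have "(y, u, t) \<in> region (y, s / 2, a, \<epsilon>)" using s(1) W(5) by (simp add: region_def)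
  ultimately show ?thesis by blast
qed

lemma ex_countable_params:
  "\<exists>J. countable J \<and> J \<subseteq> minorant_params c \<and> (\<Union>j\<in>J. region j) = (\<Union>j\<in>minorant_params c. region j)"
proof -
  obtain F where F: "F \<subseteq> region ` minorant_params c" "countable F" "\<Union>F = \<Union>(region ` minorant_params c)"
    using Lindelof[of "region ` minorant_params c"] open_region by blast
  then obtain J where "countable J" "J \<subseteq> minorant_params c" "F = region ` J"
    using countable_subset_image[of F region "minorant_params c"] by blast
  with F(3) show ?thesis by blast
qed

lemma ex_countable_atlas:
  "\<exists>A. countable A \<and> A \<subseteq> \<A> \<and> (\<Union>c\<in>A. chart_dom c) = UNIV"
proof -
  obtain F where F: "F \<subseteq> chart_dom ` \<A>" "countable F" "\<Union>F = \<Union>(chart_dom ` \<A>)"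
    using Lindelof[of "chart_dom ` \<A>"] open_chart_dom by blast
  then obtain A where A: "countable A" "A \<subseteq> \<A>" "F = chart_dom ` A"
    using countable_subset_image[of F chart_dom \<A>] by blast
  have "\<Union>(chart_dom ` \<A>) = UNIV" using ex_chart by blast
  with A F(3) show ?thesis by auto
qed

text \<open>Supplies at every point a vector to which the approximation property applies, so that
  the sets where a cutoff is 1 cover the manifold. A nonzero vector exists because the dimension is
  at least 1.\<close>

lemma ex_metric_greater: "\<exists>v t. v \<in> tangent_space \<A> x \<and> 0 < t \<and> ennreal t < \<rho> (x, v)"
proof -
  obtain c where c: "c \<in> \<A>" "x \<in> chart_dom c" using ex_chart by blast
  obtain b :: 'e where "b \<in> Basis" using nonempty_Basis by blast
  then have "tvec c x b \<noteq> 0" using tvec_eq_0_iff[OF c] nonzero_Basis by blast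
  then have "0 < \<rho> (x, tvec c x b)"
    by (rule generalised_norm_pos[OF generalised_norm_metric subspace_tangent_space
          tvec_in_tangent_space[OF c]])
  then obtain t where "0 < t" "ennreal t < \<rho> (x, tvec c x b)"
    using ex_real_between_ennreal[of 0] by auto
  with tvec_in_tangent_space[OF c] show ?thesis by blast
qed

lemma ex_pieces:
  "\<exists>\<phi> q. (\<forall>i :: nat. piece (\<phi> i) (q i)) \<and>
    (\<forall>x v t. v \<in> tangent_space \<A> x \<longrightarrow> 0 < t \<longrightarrow> ennreal t < \<rho> (x, v) \<longrightarrow>
      (\<exists>i U. open U \<and> x \<in> U \<and> (\<forall>z\<in>U. \<phi> i z = 1) \<and> t\<^sup>2 < q i (x, v)))"
proof -
  obtain J where J: "\<And>c. countable (J c)" "\<And>c. J c \<subseteq> minorant_params c"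
    "\<And>c. (\<Union>j\<in>J c. region j) = (\<Union>j\<in>minorant_params c. region j)"
    using ex_countable_params by metis
  obtain A where A: "countable A" "A \<subseteq> \<A>" "(\<Union>c\<in>A. chart_dom c) = UNIV"
    using ex_countable_atlas by blast
  define I where "I = Sigma A J"
  have I: "countable I" using A(1) J(1) by (simp add: I_def)
  have hit: "\<exists>c j. (c, j) \<in> I \<and> x \<in> chart_dom c \<and> (chart_map c x, v c, t) \<in> region j"
    if v: "v \<in> tangent_space \<A> x" and t: "0 < t" "ennreal t < \<rho> (x, v)" for x v t
  proof -
    obtain c where c: "c \<in> A" "x \<in> chart_dom c" using A(3) by blast
    then have cA: "c \<in> \<A>" using A(2) by blast
    have "\<rho> (pt c (chart_map c x, v c)) = \<rho> (x, v)"
      by (simp add: pt_chart_map[OF cA c(2)] tvec_eq[OF v cA c(2)])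
    then have "\<exists>j\<in>minorant_params c. (chart_map c x, v c, t) \<in> region j"
      using ex_region[OF cA _ t(1)] t(2) c(2) by simp
    then have "(chart_map c x, v c, t) \<in> (\<Union>j\<in>J c. region j)" using J(3)[of c] by blast
    then obtain j where "j \<in> J c" "(chart_map c x, v c, t) \<in> region j" by blast
    with c show ?thesis unfolding I_def by blast
  qed
  have "I \<noteq> {}" using ex_metric_greater hit by blast
  \<comment> \<open>If \<open>I\<close> is finite, this enumeration merely repeats its
    elements.\<close>
  define e where "e = from_nat_into I"
  have e: "e i \<in> I" for i using \<open>I \<noteq> {}\<close> by (simp add: e_def from_nat_into)
  define \<phi> where "\<phi> i = (case e i of (c, b, r, a, \<epsilon>) \<Rightarrow> cutoff c b r)" for i
  define q where "q i = (case e i of (c, b, r, a, \<epsilon>) \<Rightarrow> \<lambda>p :: 'a \<times> ('a, 'e) tvec. quad a \<epsilon> (snd p c))" for i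
  have "piece (\<phi> i) (q i)" for i
  proof -
    obtain c b r a \<epsilon> where i: "e i = (c, b, r, a, \<epsilon>)" by (cases "e i") auto
    then have "c \<in> \<A>" "(b, r, a, \<epsilon>) \<in> minorant_params c"
      using e[of i] A(2) J(2)[of c] by (auto simp: I_def)
    from piece_cutoff[OF this] show ?thesis by (simp add: \<phi>_def q_def i)
  qed
  moreover have "\<exists>i U. open U \<and> x \<in> U \<and> (\<forall>z\<in>U. \<phi> i z = 1) \<and> t\<^sup>2 < q i (x, v)"
    if v: "v \<in> tangent_space \<A> x" "0 < t" "ennreal t < \<rho> (x, v)" for x v t
  proof -
    obtain c j where cj: "(c, j) \<in> I" "x \<in> chart_dom c" "(chart_map c x, v c, t) \<in> region j"
      using hit[OF v] by blast
    obtain b r a \<epsilon> where j: "j = (b, r, a, \<epsilon>)" by (cases j) auto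
    obtain i where i: "e i = (c, b, r, a, \<epsilon>)"
      using from_nat_into_surj[OF I cj(1)] by (auto simp: e_def j)
    have cA: "c \<in> \<A>" "0 < r"
      using cj(1) A(2) J(2)[of c] by (auto simp: I_def j minorant_params_def)
    \<comment> \<open>\<open>region\<close> places the point inside the ball of radius
      \<open>r\<close> on which the cutoff equals 1; its preimage is the neighbourhood
      sought.\<close>
    let ?U = "chart_map c -` ball b r \<inter> chart_dom c"
    have "open ?U"
      using continuous_on_chart_map[OF cA(1)]
      by (intro continuous_on_open_vimage[THEN iffD1, rule_format] open_chart_dom[OF cA(1)]) auto
    moreover have "x \<in> ?U" "t\<^sup>2 < q i (x, v)"
      using cj by (simp_all add: region_def j q_def i dist_commute)
    moreover have "\<phi> i z = 1" if "z \<in> ?U" for z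
      using that cA(2) by (simp add: \<phi>_def i cutoff_def plateau_eq_1 dist_commute)
    ultimately show ?thesis by blast
  qed
  ultimately show ?thesis by blast
qed

section \<open>Global minorants\<close>

context
  fixes \<phi> :: "nat \<Rightarrow> 'a \<Rightarrow> real" and q :: "nat \<Rightarrow> 'a \<times> ('a, 'e) tvec \<Rightarrow> real"
  assumes piece: "\<And>i. piece (\<phi> i) (q i)"
    and cover: "\<And>x. \<exists>i U. open U \<and> x \<in> U \<and> (\<forall>z\<in>U. \<phi> i z = 1)"
begin

text \<open>
  Since the sets where some \<open>\<phi> i\<close> is locally equal to \<open>1\<close> cover, these weights form a locally finite partition
  of unity, without any appeal to paracompactness.
\<close>

definition weight :: "nat \<Rightarrow> 'a \<Rightarrow> real" where
  "weight i x = \<phi> i x * (\<Prod>j<i. 1 - \<phi> j x)"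

text \<open>The full series over all pieces, made finite by stopping where the remaining weights
  vanish. The stopping index may jump from point to point, but by \<open>base_eq\<close> any index
  with \<open>\<phi> m = 1\<close> gives the same value.\<close>

definition base :: "'a \<times> ('a, 'e) tvec \<Rightarrow> real" where
  "base p = (\<Sum>i\<le>(LEAST i. \<phi> i (fst p) = 1). weight i (fst p) * q i p)"

lemma weight_nonneg: "0 \<le> weight i x"
  unfolding weight_def
  by (intro mult_nonneg_nonneg prod_nonneg) (auto simp: piece_nonneg[OF piece] piece_le_1[OF piece])

lemma weight_eq_0: "\<phi> m x = 1 \<Longrightarrow> m < i \<Longrightarrow> weight i x = 0"
  by (auto simp: weight_def intro: prod_zero)

lemma base_eq:
  assumes "\<phi> m (fst p) = 1"
  shows "base p = (\<Sum>i\<le>m. weight i (fst p) * q i p)"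
  unfolding base_def
proof (rule sum.mono_neutral_left)
  have L: "\<phi> (LEAST i. \<phi> i (fst p) = 1) (fst p) = 1" using assms by (rule LeastI)
  have "(LEAST i. \<phi> i (fst p) = 1) \<le> m" using assms by (rule Least_le)
  then show "{..LEAST i. \<phi> i (fst p) = 1} \<subseteq> {..m}" by simp
  show "\<forall>i\<in>{..m} - {..LEAST i. \<phi> i (fst p) = 1}. weight i (fst p) * q i p = 0"
    using weight_eq_0[OF L] by (auto simp: not_le)
qed simp

text \<open>Telescoping: each weight is the difference of two consecutive partial products.\<close>

lemma sum_weight: "(\<Sum>i\<le>m. weight i x) = 1 - (\<Prod>i\<le>m. 1 - \<phi> i x)"
proof (induction m)
  case 0
  then show ?case by (simp add: weight_def)
next
  case (Suc m)
  have "weight (Suc m) x = \<phi> (Suc m) x * (\<Prod>i\<le>m. 1 - \<phi> i x)"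
    by (simp only: weight_def lessThan_Suc_atMost)
  with Suc show ?case by (simp add: algebra_simps)
qed

lemma sum_weight_1: "\<phi> m x = 1 \<Longrightarrow> (\<Sum>i\<le>m. weight i x) = 1"
  by (auto simp: sum_weight intro: prod_zero)

lemma ex_phi_1: "\<exists>m. \<phi> m x = 1"
  using cover by metis

lemma smooth_TM_base: "smooth_TM base"
proof (rule smooth_TM_localI)
  fix x
  obtain m U where U: "open U" "x \<in> U" "\<forall>z\<in>U. \<phi> m z = 1" using cover by blast
  \<comment> \<open>\<open>\<phi> i\<close> is kept next to \<open>q i\<close>, since only their
    product is known to be smooth.\<close>
  have "smooth_TM (\<lambda>p. \<Sum>i\<le>m. (\<Prod>j<i. 1 - \<phi> j (fst p)) * (\<phi> i (fst p) * q i p))"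
    by (intro smooth_TM_sum smooth_TM_mult smooth_TM_prod smooth_TM_diff smooth_TM_const
        piece_smooth[OF piece] piece_smooth_mult[OF piece])
  moreover have "base p = (\<Sum>i\<le>m. (\<Prod>j<i. 1 - \<phi> j (fst p)) * (\<phi> i (fst p) * q i p))"
    if "fst p \<in> U" for p
    using base_eq[of m p] U(3) that by (simp add: weight_def mult_ac)
  ultimately show "\<exists>U f. open U \<and> x \<in> U \<and> smooth_TM f \<and> (\<forall>p. fst p \<in> U \<longrightarrow> base p = f p)"
    using U(1,2) by blast
qed

lemma sq_norm_on_base: "sq_norm_on (tangent_space \<A> x) (\<lambda>v. base (x, v))"
proof -
  obtain m where m: "\<phi> m x = 1" using ex_phi_1 by blast
  have "sq_norm_on (tangent_space \<A> x) (\<lambda>v. \<Sum>i\<le>m. weight i x * q i (x, v))"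
  proof (rule sq_norm_on_sum)
    show "sq_norm_on (tangent_space \<A> x) (\<lambda>v. q i (x, v))" if "weight i x \<noteq> 0" for i
      using that by (intro piece_sq_norm[OF piece]) (auto simp: weight_def)
  qed (auto simp: weight_nonneg sum_weight_1[OF m])
  then show ?thesis using base_eq[of m] m by simp
qed

lemma below_base:
  assumes v: "v \<in> tangent_space \<A> x"
  shows "below base (x, v)"
  unfolding below_def
proof
  assume fin: "\<rho> (x, v) < \<infinity>"
  obtain m where m: "\<phi> m x = 1" using ex_phi_1 by blast
  have "weight i x * q i (x, v) \<le> weight i x * (enn2real (\<rho> (x, v)))\<^sup>2" for i
  proof (cases "weight i x = 0")
    case False
    then have "\<phi> i x \<noteq> 0" by (auto simp: weight_def)
    from piece_below[OF piece this v] fin show ?thesis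
      by (intro mult_left_mono weight_nonneg) (simp add: below_def)
  qed simp
  then have "base (x, v) \<le> (\<Sum>i\<le>m. weight i x * (enn2real (\<rho> (x, v)))\<^sup>2)"
    using base_eq[of m "(x, v)"] m by (simp add: sum_mono)
  also have "\<dots> = (enn2real (\<rho> (x, v)))\<^sup>2"
    by (simp add: sum_weight_1[OF m] flip: sum_distrib_right)
  finally show "base (x, v) \<le> (enn2real (\<rho> (x, v)))\<^sup>2" .
qed

text \<open>Interpolation with \<open>base\<close> avoids the degeneracy of a form that is merely
  cut off, and nothing is lost where the cutoff is 1, which is where the approximation is
  wanted.\<close>

definition extended :: "nat \<Rightarrow> 'a \<times> ('a, 'e) tvec \<Rightarrow> real" where
  "extended i p = \<phi> i (fst p) * q i p + (1 - \<phi> i (fst p)) * base p"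

lemma extended_eq: "\<phi> i (fst p) = 1 \<Longrightarrow> extended i p = q i p"
  by (simp add: extended_def)

lemma smooth_TM_extended: "smooth_TM (extended i)"
  unfolding extended_def[abs_def]
  by (intro smooth_TM_add smooth_TM_mult smooth_TM_diff smooth_TM_const smooth_TM_base
      piece_smooth[OF piece] piece_smooth_mult[OF piece])

text \<open>Nothing is known of \<open>q i\<close> where the cutoff is 0, and \<open>base\<close>
  drops out where it is 1; only strictly in between are both summands squares of norms.\<close>

lemma sq_norm_on_extended: "sq_norm_on (tangent_space \<A> x) (\<lambda>v. extended i (x, v))"
proof -
  consider "\<phi> i x = 0" | "\<phi> i x = 1" | "0 < \<phi> i x" "\<phi> i x < 1"
    using piece_nonneg[OF piece, of i x] piece_le_1[OF piece, of i x] by fastforce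
  then show ?thesis
  proof cases
    case 1
    then show ?thesis by (simp add: extended_def sq_norm_on_base)
  next
    case 2
    then show ?thesis using piece_sq_norm[OF piece, of i x] by (simp add: extended_eq)
  next
    case 3
    then show ?thesis
      unfolding extended_def
      by (auto intro!: sq_norm_on_add sq_norm_on_pos_scale sq_norm_on_base piece_sq_norm[OF piece])
  qed
qed

lemma below_extended:
  assumes v: "v \<in> tangent_space \<A> x"
  shows "below (extended i) (x, v)"
  unfolding below_def
proof
  let ?R = "(enn2real (\<rho> (x, v)))\<^sup>2"
  assume fin: "\<rho> (x, v) < \<infinity>"
  have "\<phi> i x * q i (x, v) \<le> \<phi> i x * ?R"
  proof (cases "\<phi> i x = 0")
    case False
    from piece_below[OF piece this v] fin show ?thesis
      by (intro mult_left_mono piece_nonneg[OF piece]) (simp add: below_def)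
  qed simp
  moreover have "(1 - \<phi> i x) * base (x, v) \<le> (1 - \<phi> i x) * ?R"
    using below_base[OF v] fin piece_le_1[OF piece] by (intro mult_left_mono) (simp_all add: below_def)
  ultimately show "extended i (x, v) \<le> ?R" by (simp add: extended_def algebra_simps)
qed

end

lemma ex_global_minorants:
  "\<exists>g :: nat \<Rightarrow> 'a \<times> ('a, 'e) tvec \<Rightarrow> real.
    (\<forall>i. smooth_TM (g i)) \<and> (\<forall>i x. sq_norm_on (tangent_space \<A> x) (\<lambda>v. g i (x, v))) \<and>
    (\<forall>i x. \<forall>v\<in>tangent_space \<A> x. below (g i) (x, v)) \<and>
    (\<forall>x v t. v \<in> tangent_space \<A> x \<longrightarrow> 0 < t \<longrightarrow> ennreal t < \<rho> (x, v) \<longrightarrow> (\<exists>i. t\<^sup>2 < g i (x, v)))"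
proof -
  obtain \<phi> q where piece: "\<And>i :: nat. piece (\<phi> i) (q i)"
    and sup: "\<And>x v t. v \<in> tangent_space \<A> x \<Longrightarrow> 0 < t \<Longrightarrow> ennreal t < \<rho> (x, v) \<Longrightarrow>
      \<exists>i U. open U \<and> x \<in> U \<and> (\<forall>z\<in>U. \<phi> i z = 1) \<and> t\<^sup>2 < q i (x, v)"
    using ex_pieces by metis
  have cover: "\<exists>i U. open U \<and> x \<in> U \<and> (\<forall>z\<in>U. \<phi> i z = 1)" for x
  proof -
    obtain v t where v: "v \<in> tangent_space \<A> x" "0 < t" "ennreal t < \<rho> (x, v)"
      using ex_metric_greater by blast
    from sup[OF v] show ?thesis by blast
  qed
  have "\<exists>i. t\<^sup>2 < extended \<phi> q i (x, v)"
    if v: "v \<in> tangent_space \<A> x" "0 < t" "ennreal t < \<rho> (x, v)" for x v t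
  proof -
    obtain i where "\<phi> i x = 1" "t\<^sup>2 < q i (x, v)" using sup[OF v] by blast
    then have "t\<^sup>2 < extended \<phi> q i (x, v)" using extended_eq[OF piece cover, of i "(x, v)"] by simp
    then show ?thesis by blast
  qed
  then show ?thesis
    using smooth_TM_extended[OF piece cover] sq_norm_on_extended[OF piece cover]
      below_extended[OF piece cover]
    by (intro exI[of _ "extended \<phi> q"]) blast
qed

end

section \<open>The approximating sequence\<close>

context atlas
begin

lemma smooth_TM0_smax:
  assumes "0 < \<epsilon>" "\<epsilon> \<le> 1" "smooth_TM0 P" "smooth_TM0 Q"
    and "\<And>x. sq_norm_on (tangent_space \<A> x) (\<lambda>v. P (x, v))"
    and "\<And>x. sq_norm_on (tangent_space \<A> x) (\<lambda>v. Q (x, v))"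
  shows "smooth_TM0 (\<lambda>p. smax \<epsilon> (P p) (Q p))"
  unfolding smooth_TM0_def
proof (intro ballI conjI)
  fix c assume c: "c \<in> \<A>"
  show "smooth_on (chart_image c \<times> - {0}) (\<lambda>p. smax \<epsilon> (P (pt c p)) (Q (pt c p)))"
    by (rule smooth_on_smax)
      (use assms(1-4) c in \<open>auto simp: smooth_TM0_def open_chart_image_Times0 less_imp_le
        simp del: mem_Times_iff intro!: sq_norm_pt_pos[OF assms(5) c] sq_norm_pt_pos[OF assms(6) c]\<close>)
  show "continuous_on (chart_image c \<times> UNIV) (\<lambda>p. smax \<epsilon> (P (pt c p)) (Q (pt c p)))"
    by (rule continuous_on_smax) (use assms(1-4) c in \<open>auto simp: smooth_TM0_def\<close>)
qed

end

text \<open>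
  The constants leave room for the loss of a factor \<open>1 + smax_const n\<close> in each smooth maximum: see
  \<open>scale_const_Suc\<close> below.
\<close>

definition scale_const :: "nat \<Rightarrow> real" where
  "scale_const n = (real n + 1) / (real n + 2)"

definition smax_const :: "nat \<Rightarrow> real" where
  "smax_const n = 1 / ((real n + 1) * (real n + 3))"

text \<open>\<open>smax_const n\<close> is chosen so that 1 + \<open>smax_const n\<close> is the
  ratio of successive scaling constants; the identity behind it is (n+1)(n+3) + 1 = (n+2)^2.\<close>

lemma scale_const_Suc: "(1 + smax_const n) * scale_const n = scale_const (Suc n)"
proof -
  have "(real n + 1) * (real n + 3) + 1 = (real n + 2)\<^sup>2" by (simp add: power2_eq_square algebra_simps)
  then have "1 + smax_const n = (real n + 2)\<^sup>2 / ((real n + 1) * (real n + 3))"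
    by (simp add: smax_const_def add_divide_eq_iff)
  then show ?thesis by (simp add: scale_const_def power2_eq_square add.commute)
qed

lemma scale_const_pos: "0 < scale_const n" and scale_const_less_1: "scale_const n < 1"
  by (simp_all add: scale_const_def)

lemma smax_const_pos: "0 < smax_const n"
  by (simp add: smax_const_def)

lemma smax_const_le_1: "smax_const n \<le> 1"
proof -
  have "1 * 1 \<le> (real n + 1) * (real n + 3)" by (rule mult_mono) auto
  then show ?thesis by (simp add: smax_const_def)
qed

lemma scale_const_tendsto: "scale_const \<longlonglongrightarrow> 1"
proof -
  have "(\<lambda>n. 1 - inverse (real (Suc (Suc n)))) \<longlonglongrightarrow> 1 - 0"
    by (intro tendsto_diff tendsto_const LIMSEQ_Suc[OF LIMSEQ_inverse_real_of_nat])
  moreover have "1 - inverse (real (Suc (Suc n))) = scale_const n" for n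
    by (simp add: scale_const_def field_simps)
  ultimately show ?thesis by simp
qed

text \<open>Every term of \<open>g\<close> is used infinitely often, so that it is also used with constants close to \<open>1\<close>.\<close>

primrec approx :: "(nat \<Rightarrow> 'p \<Rightarrow> real) \<Rightarrow> nat \<Rightarrow> 'p \<Rightarrow> real" where
  "approx g 0 = (\<lambda>p. scale_const 0 * g 0 p)"
| "approx g (Suc n) =
     (\<lambda>p. smax (smax_const n) (approx g n p) (scale_const n * g (fst (prod_decode n)) p))"

lemma approx_step:
  assumes "0 \<le> approx g n p" "0 \<le> g (fst (prod_decode n)) p"
  shows "approx g n p \<le> approx g (Suc n) p"
    and "scale_const n * g (fst (prod_decode n)) p \<le> approx g (Suc n) p"
  using smax_ge[OF less_imp_le[OF smax_const_pos] smax_const_le_1 assms(1)] assms(2) scale_const_pos[of n]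
  by (simp_all add: less_imp_le)

text \<open>The factor \<open>scale_const n\<close> is the invariant: both arguments of the smooth
  maximum are at most \<open>scale_const n * R\<close>, and the overshoot leads exactly to the next
  constant.\<close>

lemma approx_le:
  assumes "\<And>i. 0 \<le> g i p" "\<And>n. 0 \<le> approx g n p" "\<And>i. g i p \<le> R"
  shows "approx g n p \<le> scale_const n * R"
proof (induction n)
  case 0
  then show ?case using assms(3) scale_const_pos[of 0] by (simp add: mult_left_mono)
next
  case (Suc n)
  have "approx g (Suc n) p \<le> (1 + smax_const n) * (scale_const n * R)"
    unfolding approx.simps
    using assms scale_const_pos[of n] Suc
    by (intro smax_le) (auto simp: smax_const_le_1 smax_const_pos less_imp_le mult_left_mono)
  then show ?case using scale_const_Suc[of n] by (simp flip: mult.assoc)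
qed

lemma approx_sup:
  assumes g: "\<And>i. 0 \<le> g i p" "\<And>n. 0 \<le> approx g n p" and t: "0 \<le> t" "t < g i p"
  shows "\<exists>n. t < approx g n p"
proof -
  have "(\<lambda>n. scale_const n * g i p) \<longlonglongrightarrow> 1 * g i p"
    by (intro tendsto_mult scale_const_tendsto tendsto_const)
  then have "\<forall>\<^sub>F n in sequentially. t < scale_const n * g i p"
    using t by (intro order_tendstoD(1)) auto
  then obtain N where N: "\<And>n. N \<le> n \<Longrightarrow> t < scale_const n * g i p"
    by (auto simp: eventually_sequentially)
  \<comment> \<open>An index that selects \<open>g i\<close> and is at least
    \<open>N\<close>.\<close>
  define n where "n = prod_encode (i, N)"
  have "t < scale_const n * g i p" using N le_prod_encode_2 by (simp add: n_def)
  also have "\<dots> \<le> approx g (Suc n) p"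
    using approx_step(2)[of g n p] g by (simp add: n_def)
  finally show ?thesis by blast
qed

theorem theorem3p11:
  fixes \<A> :: "('a::{t2_space,second_countable_topology}, 'e::euclidean_space) chart set"
    and \<rho> :: "'a \<times> ('a, 'e) tvec \<Rightarrow> ennreal"
  assumes "smooth_manifold \<A>"
    and "generalised_metric \<A> \<rho>"
  shows "\<exists>F :: nat \<Rightarrow> 'a \<times> ('a, 'e) tvec \<Rightarrow> real.
           (\<forall>n. finsler_metric \<A> (F n)) \<and>
           (\<forall>x. \<forall>v\<in>tangent_space \<A> x.
              incseq (\<lambda>n. F n (x, v)) \<and>
              (\<lambda>n. ennreal (F n (x, v))) \<longlonglongrightarrow> \<rho> (x, v))"
proof -
  interpret metric_atlas \<A> \<rho>
    using assms by unfold_locales (simp_all add: smooth_manifold_def)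
  obtain g where sm: "\<And>i :: nat. smooth_TM (g i)"
    and q: "\<And>i x. sq_norm_on (tangent_space \<A> x) (\<lambda>v. g i (x, v))"
    and below: "\<And>i x v. v \<in> tangent_space \<A> x \<Longrightarrow> below (g i) (x, v)"
    and sup: "\<And>x v t. v \<in> tangent_space \<A> x \<Longrightarrow> 0 < t \<Longrightarrow> ennreal t < \<rho> (x, v) \<Longrightarrow>
      \<exists>i. t\<^sup>2 < g i (x, v)"
    using ex_global_minorants by metis
  let ?Q = "approx g"
  have scaled: "smooth_TM0 (\<lambda>p. scale_const n * g i p)"
    "sq_norm_on (tangent_space \<A> x) (\<lambda>v. scale_const n * g i (x, v))" for n i x
    by (intro smooth_TM_imp_TM0 smooth_TM_mult smooth_TM_const sm)
      (rule sq_norm_on_pos_scale[OF q scale_const_pos])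
  have Q_sq: "sq_norm_on (tangent_space \<A> x) (\<lambda>v. ?Q n (x, v))" for n x
    by (induction n)
      (simp_all add: scaled sq_norm_on_smax subspace_tangent_space smax_const_le_1 smax_const_pos less_imp_le)
  have Q_sm: "smooth_TM0 (?Q n)" for n
    by (induction n) (simp_all add: scaled smooth_TM0_smax smax_const_pos smax_const_le_1 Q_sq)
  have "incseq (\<lambda>n. sqrt (?Q n (x, v))) \<and> (\<lambda>n. ennreal (sqrt (?Q n (x, v)))) \<longlonglongrightarrow> \<rho> (x, v)"
    if v: "v \<in> tangent_space \<A> x" for x v
  proof -
    have g0: "0 \<le> g i (x, v)" and Q0: "0 \<le> ?Q n (x, v)" for i n
      using sq_norm_on_nonneg[OF q subspace_tangent_space v]
        sq_norm_on_nonneg[OF Q_sq subspace_tangent_space v] by auto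
    have inc: "incseq (\<lambda>n. sqrt (?Q n (x, v)))"
      using approx_step(1)[OF Q0 g0] by (intro incseq_SucI) simp
    have le: "ennreal (sqrt (?Q n (x, v))) \<le> \<rho> (x, v)" for n
    proof (rule sqrt_le_if_below)
      show "below (?Q n) (x, v)"
        unfolding below_def
      proof
        assume "\<rho> (x, v) < \<infinity>"
        then have "g i (x, v) \<le> (enn2real (\<rho> (x, v)))\<^sup>2" for i
          using below[OF v] by (simp add: below_def)
        with g0 Q0 have "?Q n (x, v) \<le> scale_const n * (enn2real (\<rho> (x, v)))\<^sup>2" by (rule approx_le)
        also have "\<dots> \<le> (enn2real (\<rho> (x, v)))\<^sup>2"
          using scale_const_less_1[of n] scale_const_pos[of n] by (intro mult_left_le_one_le) auto
        finally show "?Q n (x, v) \<le> (enn2real (\<rho> (x, v)))\<^sup>2" .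
      qed
    qed
    \<comment> \<open>Comparison with all smaller values, which are real numbers, treats finite and
      infinite \<open>\<rho> (x, v)\<close> alike.\<close>
    have "\<rho> (x, v) \<le> (SUP n. ennreal (sqrt (?Q n (x, v))))"
    proof (rule dense_le)
      fix z assume z: "z < \<rho> (x, v)"
      then obtain t where t: "z = ennreal t" "0 \<le> t" by (cases z) auto
      show "z \<le> (SUP n. ennreal (sqrt (?Q n (x, v))))"
      \<comment> \<open>The minorants are known to exceed \<open>t\<^sup>2\<close> only for positive
        \<open>t\<close>; for 0 the bound is trivial.\<close>
      proof (cases "t = 0")
        case False
        then obtain i where "t\<^sup>2 < g i (x, v)" using sup[OF v, of t] t z by auto
        from approx_sup[where g = g and p = "(x, v)", OF g0 Q0 zero_le_power2 this]
        obtain n where "t\<^sup>2 < ?Q n (x, v)" by blast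
        then have "t \<le> sqrt (?Q n (x, v))" by (simp add: real_le_rsqrt)
        then have "z \<le> ennreal (sqrt (?Q n (x, v)))" using t by (simp add: ennreal_leI)
        then show ?thesis by (rule order_trans) (rule SUP_upper, simp)
      qed (simp add: t)
    qed
    with le have "\<rho> (x, v) = (SUP n. ennreal (sqrt (?Q n (x, v))))"
      by (intro antisym SUP_least) auto
    moreover have "incseq (\<lambda>n. ennreal (sqrt (?Q n (x, v))))"
      using inc by (auto simp: incseq_def intro: ennreal_leI)
    ultimately show ?thesis using inc LIMSEQ_SUP by metis
  qed
  then show ?thesis
    using finsler_metric_sqrt[OF Q_sm Q_sq] by (intro exI[of _ "\<lambda>n p. sqrt (?Q n p)"]) blast
qed

end
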